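(* Let $G$ be a finite group of order $N$ and let $X$ be a $G$-$\mathcal{AS}$-set. For $k\in\mathbb{N}$ denote $X_{(k)}:=\pi_k(X\times V_N(\mathbb{R}^k))$, the geometric quotient of $X\times V_N(\mathbb{R}^k)$ by $G$. The inductive system of inclusions $X_{(k)}\to X_{(k+1)}$ induces an isomorphism $$\varinjlim_{k\in\mathbb{N}}H_*(X_{(k)})\to H^G_*(X).$$
   Context: $H_*(\,\cdot\,)$ denotes singular homology with coefficients in $\mathbb{Z}_2:=\mathbb{Z}/2\mathbb{Z}$. A semialgebraic set $A\subset\mathbb{P}^d(\mathbb{R})$ is arc-symmetric if for every real analytic arc $\gamma:(-1,1)\to\mathbb{P}^d(\mathbb{R})$, $\gamma((-1,0))\subset A$ implies $\gamma((-1,1))\subset A$; an $\mathcal{AS}$-set is a Boolean combination of arc-symmetric sets. A $G$-$\mathcal{AS}$-set is an $\mathcal{AS}$-set $X\subset\mathbb{P}^d(\mathbb{R})$ with an action of $G$ by biregular isomorphisms on its Zariski closure in $\mathbb{P}^d(\mathbb{R})$ which globally stabilizes $X$. Up to equivariant biregular isomorphism, $X$ is realized as an $\mathcal{AS}$-set $X\subset\mathbb{R}^d$ with compact Zariski closure in $\mathbb{R}^d$, the action being induced by a linear action of $G$ on $\mathbb{R}^d$ by permutations of coordinates. For $k\in\mathbb{N}$, $V_N(\mathbb{R}^k)$ is the Stiefel manifold of $k\times N$ real matrices $A$ with ${}^tAA=I_N$, and $V_N(\mathbb{R}^\infty)=\varinjlim_kV_N(\mathbb{R}^k)$, which is contractible.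 Embed $G$ in $O_N(\mathbb{R})$ by permutation matrices; $G$ acts freely on $V_N(\mathbb{R}^k)$, $k\in\mathbb{N}\cup\{\infty\}$, by $g\cdot A=Ag^{-1}$ (for finite $k$, restriction of a linear action on $\mathbb{R}^{Nk}$). Let $G$ act diagonally on $\mathbb{R}^d\times\mathbb{R}^{Nk}$, let $p_1,\dots,p_m$ generate the $\mathbb{R}$-algebra of $G$-invariant polynomials on it and $\pi_k=(p_1,\dots,p_m)$, with values in $\mathbb{R}^m$ ($m$ depends on $k$). The inclusion $\mathbb{R}^k\subset\mathbb{R}^{k+1}$ (last coordinate zero) induces closed inclusions $X_{(k)}\to X_{(k+1)}$, $\pi_k(x,A)\mapsto\pi_{k+1}(x,A)$ (generators for $k+1$ being those for $k$ together with polynomials vanishing when the new coordinates vanish). $H^G_*(X):=H_*((X\times E_G)/G)$, with $E_G$ a contractible space with a free $G$-action; here $E_G=V_N(\mathbb{R}^\infty)$. The maps $X_{(k)}\to(X\times V_N(\mathbb{R}^\infty))/G$, $\pi_k(x,A)\mapsto[(x,A)]$, identify $\varinjlim_kX_{(k)}$ with $(X\times V_N(\mathbb{R}^\infty))/G$ and induce the map in the claim. *)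

theory Defs
  imports
    "HOL-Analysis.Analysis"
    "HOL-Algebra.Group_Action"
    "HOL-Homology.Homology"
    "HOL-Library.Z2"
begin

section \<open>Singular homology with coefficients in the field with two elements\<close>

text \<open>
  The library provides integral singular homology. Here chains have coefficients in
  \<^typ>\<open>bit\<close>, with the singular simplices, faces and simplex maps of the library. The signs in
  the boundary are omitted, since \<open>-1 = 1\<close>, and every simplex occurring in a chain has
  coefficient \<open>1\<close>.
\<close>

type_synonym 'a chain2 = "((nat \<Rightarrow> real) \<Rightarrow> 'a) \<Rightarrow>\<^sub>0 bit"

definition chains2 :: "nat \<Rightarrow> 'a topology \<Rightarrow> 'a chain2 set" where
  "chains2 p X = {c. Poly_Mapping.keys c \<subseteq> singular_simplex_set p X}"

definition boundary2 :: "nat \<Rightarrow> 'a chain2 \<Rightarrow> 'a chain2" where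
  "boundary2 p c =
     (if p = 0 then 0
      else \<Sum>f\<in>Poly_Mapping.keys c. \<Sum>k\<le>p. Poly_Mapping.single (singular_face p k f) 1)"

definition chain_map2 :: "nat \<Rightarrow> ('a \<Rightarrow> 'b) \<Rightarrow> 'a chain2 \<Rightarrow> 'b chain2" where
  "chain_map2 p h c = (\<Sum>f\<in>Poly_Mapping.keys c. Poly_Mapping.single (simplex_map p h f) 1)"

definition cycles2 :: "nat \<Rightarrow> 'a topology \<Rightarrow> 'a chain2 monoid" where
  "cycles2 p X =
     \<lparr>carrier = {c \<in> chains2 p X. boundary2 p c = 0}, monoid.mult = (+), one = 0\<rparr>"

definition boundaries2 :: "nat \<Rightarrow> 'a topology \<Rightarrow> 'a chain2 set" where
  "boundaries2 p X = boundary2 (Suc p) ` chains2 (Suc p) X"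

definition homology2 :: "nat \<Rightarrow> 'a topology \<Rightarrow> 'a chain2 set monoid" where
  "homology2 p X = cycles2 p X Mod boundaries2 p X"

text \<open>The map on homology induced by a continuous \<open>h\<close> into \<open>Y\<close>: the class \<open>C\<close> of a cycle \<open>c\<close>
  goes to the class of the image of \<open>c\<close>. All members \<open>c\<close> of \<open>C\<close> contribute the same coset.\<close>

definition hom_induced2 ::
    "nat \<Rightarrow> 'b topology \<Rightarrow> ('a \<Rightarrow> 'b) \<Rightarrow> 'a chain2 set \<Rightarrow> 'b chain2 set" where
  "hom_induced2 p Y h C = (\<Union>c\<in>C. boundaries2 p Y #>\<^bsub>cycles2 p Y\<^esub> chain_map2 p h c)"


section \<open>Direct limit of a sequence of groups\<close>

text \<open>\<open>shift f i m\<close> is the transition map from the \<open>i\<close>-th to the \<open>(i + m)\<close>-th group of the system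
  with bonding maps \<open>f i\<close> from the \<open>i\<close>-th to the \<open>(i + 1)\<close>-st group.\<close>

primrec shift :: "(nat \<Rightarrow> 'a \<Rightarrow> 'a) \<Rightarrow> nat \<Rightarrow> nat \<Rightarrow> 'a \<Rightarrow> 'a" where
  "shift f i 0 a = a"
| "shift f i (Suc m) a = f (i + m) (shift f i m a)"

definition germ :: "(nat \<Rightarrow> 'a monoid) \<Rightarrow> (nat \<Rightarrow> 'a \<Rightarrow> 'a) \<Rightarrow> nat \<Rightarrow> 'a \<Rightarrow> (nat \<times> 'a) set" where
  "germ H f i a =
     {(j, b). b \<in> carrier (H j) \<and> (\<exists>m m'. i + m = j + m' \<and> shift f i m a = shift f j m' b)}"

text \<open>Two classes are multiplied after moving representatives to a common stage; the union ranges
  over all choices of representatives, which all give the same class.\<close>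

definition direct_limit ::
    "(nat \<Rightarrow> 'a monoid) \<Rightarrow> (nat \<Rightarrow> 'a \<Rightarrow> 'a) \<Rightarrow> (nat \<times> 'a) set monoid" where
  "direct_limit H f =
     \<lparr>carrier = {germ H f i a | i a. a \<in> carrier (H i)},
      monoid.mult = (\<lambda>C D. \<Union>(i, a)\<in>C. \<Union>(j, b)\<in>D.
                germ H f (i + j) (shift f i j a \<otimes>\<^bsub>H (i + j)\<^esub> shift f j i b)),
      one = germ H f 0 \<one>\<^bsub>H 0\<^esub>\<rparr>"

text \<open>The map out of the direct limit induced by a compatible family \<open>u i\<close> of maps on the stages.\<close>

definition direct_limit_map :: "(nat \<Rightarrow> 'a \<Rightarrow> 'b) \<Rightarrow> (nat \<times> 'a) set \<Rightarrow> 'b" where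
  "direct_limit_map u C = the_elem ((\<lambda>(i, a). u i a) ` C)"


section \<open>Quotient and colimit topologies\<close>

definition quotient_topology :: "'a topology \<Rightarrow> ('a \<Rightarrow> 'b) \<Rightarrow> 'b topology" where
  "quotient_topology T q =
     topology (\<lambda>U. U \<subseteq> q ` topspace T \<and> openin T {x \<in> topspace T. q x \<in> U})"

lemma openin_quotient_topology:
  "openin (quotient_topology T q) U \<longleftrightarrow>
     U \<subseteq> q ` topspace T \<and> openin T {x \<in> topspace T. q x \<in> U}"
proof -
  have "istopology (\<lambda>U. U \<subseteq> q ` topspace T \<and> openin T {x \<in> topspace T. q x \<in> U})"
    unfolding istopology_def
  proof (intro conjI allI impI)
    fix U V
    assume U: "U \<subseteq> q ` topspace T \<and> openin T {x \<in> topspace T. q x \<in> U}"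
      and V: "V \<subseteq> q ` topspace T \<and> openin T {x \<in> topspace T. q x \<in> V}"
    show "U \<inter> V \<subseteq> q ` topspace T" using U by blast
    have "{x \<in> topspace T. q x \<in> U \<inter> V} =
            {x \<in> topspace T. q x \<in> U} \<inter> {x \<in> topspace T. q x \<in> V}"
      by blast
    then show "openin T {x \<in> topspace T. q x \<in> U \<inter> V}"
      using U V by (simp only: openin_Int)
  next
    fix K
    assume K: "\<forall>U\<in>K. U \<subseteq> q ` topspace T \<and> openin T {x \<in> topspace T. q x \<in> U}"
    then show "\<Union>K \<subseteq> q ` topspace T" by blast
    have "{x \<in> topspace T. q x \<in> \<Union>K} = \<Union>((\<lambda>U. {x \<in> topspace T. q x \<in> U}) ` K)"
      by auto
    moreover have "openin T (\<Union>((\<lambda>U. {x \<in> topspace T. q x \<in> U}) ` K))"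
      by (rule openin_Union) (use K in blast)
    ultimately show "openin T {x \<in> topspace T. q x \<in> \<Union>K}" by (simp only:)
  qed
  then show ?thesis
    unfolding quotient_topology_def by (simp only: topology_inverse')
qed

text \<open>The topology on the union of an increasing sequence of subsets of \<open>T\<close> in which a set is open
  iff its trace on each stage is open: the topology of the direct limit.\<close>

definition colimit_topology :: "'a topology \<Rightarrow> (nat \<Rightarrow> 'a set) \<Rightarrow> 'a topology" where
  "colimit_topology T S =
     topology (\<lambda>U. U \<subseteq> (\<Union>k. S k) \<and> (\<forall>k. openin (subtopology T (S k)) (U \<inter> S k)))"

lemma openin_colimit_topology:
  "openin (colimit_topology T S) U \<longleftrightarrow>
     U \<subseteq> (\<Union>k. S k) \<and> (\<forall>k. openin (subtopology T (S k)) (U \<inter> S k))"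
proof -
  have "istopology (\<lambda>U. U \<subseteq> (\<Union>k. S k) \<and> (\<forall>k. openin (subtopology T (S k)) (U \<inter> S k)))"
    unfolding istopology_def
  proof (intro conjI allI impI)
    fix U V k
    assume U: "U \<subseteq> (\<Union>k. S k) \<and> (\<forall>k. openin (subtopology T (S k)) (U \<inter> S k))"
      and V: "V \<subseteq> (\<Union>k. S k) \<and> (\<forall>k. openin (subtopology T (S k)) (V \<inter> S k))"
    show "U \<inter> V \<subseteq> (\<Union>k. S k)" using U by blast
    have "U \<inter> V \<inter> S k = (U \<inter> S k) \<inter> (V \<inter> S k)" by blast
    then show "openin (subtopology T (S k)) (U \<inter> V \<inter> S k)"
      using U V by (simp only: openin_Int)
  next
    fix K k
    assume K: "\<forall>U\<in>K. U \<subseteq> (\<Union>k. S k) \<and> (\<forall>k. openin (subtopology T (S k)) (U \<inter> S k))"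
    then show "\<Union>K \<subseteq> (\<Union>k. S k)" by blast
    have "\<Union>K \<inter> S k = \<Union>((\<lambda>U. U \<inter> S k) ` K)" by blast
    moreover have "openin (subtopology T (S k)) (\<Union>((\<lambda>U. U \<inter> S k) ` K))"
      by (rule openin_Union) (use K in blast)
    ultimately show "openin (subtopology T (S k)) (\<Union>K \<inter> S k)" by (simp only:)
  qed
  then show ?thesis
    unfolding colimit_topology_def by (simp only: topology_inverse')
qed


section \<open>Polynomial functions\<close>

text \<open>The algebra of real functions generated by a set of functions. As the field of real numbers
  is infinite, the polynomial ring in finitely many variables is the algebra of functions
  generated by the corresponding coordinates. Points of \<open>\<real>\<^sup>n\<close> are sequences vanishing from index
  \<open>n\<close> on, so that \<open>\<real>\<^sup>n\<close> is \<open>topspace (Euclidean_space n)\<close>; polynomials in \<open>n\<close> variables are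
  functions on all sequences that only involve the first \<open>n\<close> coordinates.\<close>

inductive_set generated_algebra :: "('a \<Rightarrow> real) set \<Rightarrow> ('a \<Rightarrow> real) set" for S where
  const: "(\<lambda>_. c) \<in> generated_algebra S"
| gen: "f \<in> S \<Longrightarrow> f \<in> generated_algebra S"
| add: "\<lbrakk>f \<in> generated_algebra S; g \<in> generated_algebra S\<rbrakk>
    \<Longrightarrow> (\<lambda>x. f x + g x) \<in> generated_algebra S"
| mult: "\<lbrakk>f \<in> generated_algebra S; g \<in> generated_algebra S\<rbrakk>
    \<Longrightarrow> (\<lambda>x. f x * g x) \<in> generated_algebra S"

definition polynomials :: "nat \<Rightarrow> ((nat \<Rightarrow> real) \<Rightarrow> real) set" where
  "polynomials n = generated_algebra {\<lambda>x. x i | i. i < n}"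

definition forms :: "nat \<Rightarrow> nat \<Rightarrow> ((nat \<Rightarrow> real) \<Rightarrow> real) set" where
  "forms n e = {F \<in> polynomials n. \<forall>c x. F (\<lambda>i. c * x i) = c ^ e * F x}"

inductive_set boolean_combinations :: "'a set \<Rightarrow> 'a set set \<Rightarrow> 'a set set" for \<Omega> M where
  basic: "A \<in> M \<Longrightarrow> A \<in> boolean_combinations \<Omega> M"
| compl: "A \<in> boolean_combinations \<Omega> M \<Longrightarrow> \<Omega> - A \<in> boolean_combinations \<Omega> M"
| union: "\<lbrakk>A \<in> boolean_combinations \<Omega> M; B \<in> boolean_combinations \<Omega> M\<rbrakk>
    \<Longrightarrow> A \<union> B \<in> boolean_combinations \<Omega> M"

definition semialgebraic_sets :: "nat \<Rightarrow> (nat \<Rightarrow> real) set set" where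
  "semialgebraic_sets n =
     boolean_combinations (topspace (Euclidean_space n))
       {{x \<in> topspace (Euclidean_space n). f x > 0} | f. f \<in> polynomials n}"


section \<open>Real projective space\<close>

text \<open>A point of real projective \<open>n\<close>-space is the set of nonzero multiples of a nonzero vector
  with homogeneous coordinates \<open>0, \<dots>, n\<close>.\<close>

type_synonym proj_point = "(nat \<Rightarrow> real) set"

definition nonzero_vectors :: "nat \<Rightarrow> (nat \<Rightarrow> real) set" where
  "nonzero_vectors n = topspace (Euclidean_space n) - {\<lambda>_. 0}"

definition proj_pt :: "(nat \<Rightarrow> real) \<Rightarrow> proj_point" where
  "proj_pt v = {\<lambda>i. c * v i | c. c \<noteq> 0}"

definition proj_space :: "nat \<Rightarrow> proj_point set" where
  "proj_space n = proj_pt ` nonzero_vectors (Suc n)"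

definition proj_topology :: "nat \<Rightarrow> proj_point topology" where
  "proj_topology n =
     quotient_topology (subtopology (Euclidean_space (Suc n)) (nonzero_vectors (Suc n))) proj_pt"

text \<open>The standard embedding of \<open>\<real>\<^sup>d\<close>, with the hyperplane at infinity given by the vanishing of
  the last homogeneous coordinate.\<close>

definition affine_pt :: "nat \<Rightarrow> (nat \<Rightarrow> real) \<Rightarrow> proj_point" where
  "affine_pt d x = proj_pt (x(d := 1))"

definition zariski_closed :: "nat \<Rightarrow> proj_point set \<Rightarrow> bool" where
  "zariski_closed n Z \<longleftrightarrow>
     (\<exists>S \<subseteq> (\<Union>e. forms (Suc n) e).
        Z = proj_pt ` {v \<in> nonzero_vectors (Suc n). \<forall>F\<in>S. F v = 0})"

definition zariski_closure :: "nat \<Rightarrow> proj_point set \<Rightarrow> proj_point set" where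
  "zariski_closure n X = \<Inter>{Z. zariski_closed n Z \<and> X \<subseteq> Z}"

definition affine_zariski_closure :: "nat \<Rightarrow> (nat \<Rightarrow> real) set \<Rightarrow> (nat \<Rightarrow> real) set" where
  "affine_zariski_closure d Y =
     \<Inter>{Z. Y \<subseteq> Z \<and> (\<exists>S \<subseteq> polynomials d. Z = {x \<in> topspace (Euclidean_space d). \<forall>f\<in>S. f x = 0})}"

text \<open>A map between subsets of projective spaces is regular if, Zariski-locally, its homogeneous
  coordinates are forms of a common degree without common zero.\<close>

definition regular_map ::
    "nat \<Rightarrow> proj_point set \<Rightarrow> nat \<Rightarrow> proj_point set \<Rightarrow> (proj_point \<Rightarrow> proj_point) \<Rightarrow> bool" where
  "regular_map n S m T f \<longleftrightarrow> f ` S \<subseteq> T \<and>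
     (\<forall>x\<in>S. \<exists>Z e F. zariski_closed n Z \<and> x \<notin> Z \<and> (\<forall>i\<le>m. F i \<in> forms (Suc n) e) \<and>
        (\<forall>v\<in>nonzero_vectors (Suc n). proj_pt v \<in> S - Z \<longrightarrow>
           (\<exists>i\<le>m. F i v \<noteq> 0) \<and> f (proj_pt v) = proj_pt (\<lambda>i. if i \<le> m then F i v else 0)))"

definition biregular_map ::
    "nat \<Rightarrow> proj_point set \<Rightarrow> nat \<Rightarrow> proj_point set \<Rightarrow> (proj_point \<Rightarrow> proj_point) \<Rightarrow> bool" where
  "biregular_map n S m T f \<longleftrightarrow>
     bij_betw f S T \<and> regular_map n S m T f \<and> regular_map m T n S (inv_into S f)"


section \<open>\<open>AS\<close>-sets with a group action\<close>

text \<open>An arc is analytic if it lifts, locally around each parameter \<open>t\<close>, to homogeneous coordinates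
  that are given by power series centred at \<open>t\<close>.\<close>

definition analytic_arc :: "nat \<Rightarrow> (real \<Rightarrow> proj_point) \<Rightarrow> bool" where
  "analytic_arc n \<gamma> \<longleftrightarrow>
     (\<forall>t\<in>{-1<..<1}. \<exists>r>0. \<exists>a v. \<forall>s\<in>{-1<..<1}. \<bar>s - t\<bar> < r \<longrightarrow>
        v s \<in> nonzero_vectors (Suc n) \<and> \<gamma> s = proj_pt (v s) \<and>
        (\<forall>i\<le>n. (\<lambda>m. a i m * (s - t) ^ m) sums v s i))"

text \<open>A set of projective points is semialgebraic if the cone over it is.\<close>

definition arc_symmetric_sets :: "nat \<Rightarrow> proj_point set set" where
  "arc_symmetric_sets n =
     {A. A \<subseteq> proj_space n \<and>
         {v \<in> nonzero_vectors (Suc n). proj_pt v \<in> A} \<in> semialgebraic_sets (Suc n) \<and>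
         (\<forall>\<gamma>. analytic_arc n \<gamma> \<longrightarrow> \<gamma> ` {-1<..<0} \<subseteq> A \<longrightarrow> \<gamma> ` {-1<..<1} \<subseteq> A)}"

definition AS_sets :: "nat \<Rightarrow> proj_point set set" where
  "AS_sets n = boolean_combinations (proj_space n) (arc_symmetric_sets n)"

definition G_AS_set ::
    "('g, 'b) monoid_scheme \<Rightarrow> nat \<Rightarrow> ('g \<Rightarrow> proj_point \<Rightarrow> proj_point) \<Rightarrow> proj_point set \<Rightarrow> bool" where
  "G_AS_set G n \<alpha> X \<longleftrightarrow>
     X \<in> AS_sets n \<and>
     group_action G (zariski_closure n X) \<alpha> \<and>
     (\<forall>g\<in>carrier G. biregular_map n (zariski_closure n X) n (zariski_closure n X) (\<alpha> g)) \<and>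
     (\<forall>g\<in>carrier G. \<alpha> g ` X = X)"

text \<open>The linear action on \<open>\<real>\<^sup>d\<close> permuting the coordinates according to an action \<open>\<tau>\<close> of the group on
  the set of indices: the \<open>j\<close>-th basis vector is sent to the \<open>\<tau> g j\<close>-th.\<close>

definition coordinate_action ::
    "('g, 'b) monoid_scheme \<Rightarrow> nat \<Rightarrow> ('g \<Rightarrow> nat \<Rightarrow> nat) \<Rightarrow> 'g \<Rightarrow> (nat \<Rightarrow> real) \<Rightarrow> nat \<Rightarrow> real" where
  "coordinate_action G d \<tau> g x = (\<lambda>i. if i < d then x (\<tau> (inv\<^bsub>G\<^esub> g) i) else 0)"

text \<open>\<open>\<Phi>\<close> is an equivariant biregular isomorphism from (the Zariski closure of) \<open>X\<close> to (the compact
  Zariski closure of) an \<open>AS\<close>-set in \<open>\<real>\<^sup>d\<close> on which the group permutes the coordinates.\<close>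

definition affine_realization ::
    "('g, 'b) monoid_scheme \<Rightarrow> nat \<Rightarrow> ('g \<Rightarrow> proj_point \<Rightarrow> proj_point) \<Rightarrow> proj_point set \<Rightarrow>
     nat \<Rightarrow> ('g \<Rightarrow> nat \<Rightarrow> nat) \<Rightarrow> (proj_point \<Rightarrow> nat \<Rightarrow> real) \<Rightarrow> bool" where
  "affine_realization G n \<alpha> X d \<tau> \<Phi> \<longleftrightarrow>
     group_action G {..<d} \<tau> \<and>
     \<Phi> ` X \<subseteq> topspace (Euclidean_space d) \<and>
     affine_pt d ` \<Phi> ` X \<in> AS_sets d \<and>
     compactin (Euclidean_space d) (affine_zariski_closure d (\<Phi> ` X)) \<and>
     \<Phi> ` zariski_closure n X = affine_zariski_closure d (\<Phi> ` X) \<and>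
     biregular_map n (zariski_closure n X) d (affine_pt d ` affine_zariski_closure d (\<Phi> ` X))
       (affine_pt d \<circ> \<Phi>) \<and>
     (\<forall>g\<in>carrier G. \<forall>x\<in>zariski_closure n X. \<Phi> (\<alpha> g x) = coordinate_action G d \<tau> g (\<Phi> x))"


section \<open>Stiefel manifolds and the Borel construction\<close>

text \<open>A \<open>k \<times> N\<close> matrix is a function on index pairs that vanishes outside of the \<open>k \<times> N\<close> block, so
  that adding a zero row is the inclusion of \<open>matrices k N\<close> in \<open>matrices (Suc k) N\<close>.\<close>

type_synonym real_matrix = "nat \<times> nat \<Rightarrow> real"

definition matrices :: "nat \<Rightarrow> nat \<Rightarrow> real_matrix set" where
  "matrices k N = {A. \<forall>i j. k \<le> i \<or> N \<le> j \<longrightarrow> A (i, j) = 0}"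

definition stiefel :: "nat \<Rightarrow> nat \<Rightarrow> real_matrix set" where
  "stiefel N k =
     {A \<in> matrices k N. \<forall>j<N. \<forall>l<N. (\<Sum>i<k. A (i, j) * A (i, l)) = (if j = l then 1 else 0)}"

definition stiefel_infinity :: "nat \<Rightarrow> real_matrix topology" where
  "stiefel_infinity N = colimit_topology (powertop_real UNIV) (stiefel N)"

text \<open>\<open>A\<close> times the inverse of the permutation matrix of \<open>g\<close>, where the latter sends the \<open>j\<close>-th basis
  vector to the \<open>\<rho> g j\<close>-th: column \<open>j\<close> of the product is column \<open>\<rho> (inv g) j\<close> of \<open>A\<close>.\<close>

definition matrix_action ::
    "('g, 'b) monoid_scheme \<Rightarrow> nat \<Rightarrow> ('g \<Rightarrow> nat \<Rightarrow> nat) \<Rightarrow> 'g \<Rightarrow> real_matrix \<Rightarrow> real_matrix" where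
  "matrix_action G N \<rho> g A = (\<lambda>(i, j). if j < N then A (i, \<rho> (inv\<^bsub>G\<^esub> g) j) else 0)"

definition orbit_space ::
    "('g, 'b) monoid_scheme \<Rightarrow> ('g \<Rightarrow> 'a \<Rightarrow> 'a) \<Rightarrow> 'a topology \<Rightarrow> 'a set topology" where
  "orbit_space G \<phi> T = quotient_topology T (orbit G \<phi>)"

definition borel_action ::
    "('g, 'b) monoid_scheme \<Rightarrow> nat \<Rightarrow> ('g \<Rightarrow> nat \<Rightarrow> nat) \<Rightarrow> ('g \<Rightarrow> 'x \<Rightarrow> 'x) \<Rightarrow>
     'g \<Rightarrow> 'x \<times> real_matrix \<Rightarrow> 'x \<times> real_matrix" where
  "borel_action G N \<rho> \<alpha> g = map_prod (\<alpha> g) (matrix_action G N \<rho> g)"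

text \<open>The space \<open>(X \<times> E\<^sub>G) / G\<close>, where \<open>E\<^sub>G\<close> is the infinite Stiefel manifold.\<close>

definition borel_space ::
    "('g, 'b) monoid_scheme \<Rightarrow> nat \<Rightarrow> ('g \<Rightarrow> nat \<Rightarrow> nat) \<Rightarrow> nat \<Rightarrow>
     ('g \<Rightarrow> proj_point \<Rightarrow> proj_point) \<Rightarrow> proj_point set \<Rightarrow> (proj_point \<times> real_matrix) set topology" where
  "borel_space G N \<rho> n \<alpha> X =
     orbit_space G (borel_action G N \<rho> \<alpha>)
       (prod_topology (subtopology (proj_topology n) X) (stiefel_infinity N))"

definition equivariant_homology2 where
  "equivariant_homology2 p G N \<rho> n \<alpha> X = homology2 p (borel_space G N \<rho> n \<alpha> X)"


section \<open>The algebraic approximations of the Borel construction\<close>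

definition product_polynomials ::
    "nat \<Rightarrow> nat \<Rightarrow> nat \<Rightarrow> ((nat \<Rightarrow> real) \<times> real_matrix \<Rightarrow> real) set" where
  "product_polynomials d k N =
     generated_algebra
       ({\<lambda>z. fst z i | i. i < d} \<union> {\<lambda>z. snd z (i, j) | i j. i < k \<and> j < N})"

definition invariant_polynomials ::
    "('g, 'b) monoid_scheme \<Rightarrow> nat \<Rightarrow> ('g \<Rightarrow> nat \<Rightarrow> nat) \<Rightarrow> nat \<Rightarrow> ('g \<Rightarrow> nat \<Rightarrow> nat) \<Rightarrow> nat \<Rightarrow>
     ((nat \<Rightarrow> real) \<times> real_matrix \<Rightarrow> real) set" where
  "invariant_polynomials G d \<tau> N \<rho> k =
     {f \<in> product_polynomials d k N.
        \<forall>g\<in>carrier G. \<forall>z\<in>topspace (Euclidean_space d) \<times> matrices k N.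
          f (borel_action G N \<rho> (coordinate_action G d \<tau>) g z) = f z}"

definition invariant_generators ::
    "('g, 'b) monoid_scheme \<Rightarrow> nat \<Rightarrow> ('g \<Rightarrow> nat \<Rightarrow> nat) \<Rightarrow> nat \<Rightarrow> ('g \<Rightarrow> nat \<Rightarrow> nat) \<Rightarrow>
     (nat \<Rightarrow> ((nat \<Rightarrow> real) \<times> real_matrix \<Rightarrow> real) list) \<Rightarrow> bool" where
  "invariant_generators G d \<tau> N \<rho> P \<longleftrightarrow>
     (\<forall>k. generated_algebra (set (P k)) = invariant_polynomials G d \<tau> N \<rho> k) \<and>
     (\<forall>k. \<exists>Q. P (Suc k) = P k @ Q \<and>
        (\<forall>q\<in>set Q. \<forall>z\<in>topspace (Euclidean_space d) \<times> matrices k N. q z = 0))"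

text \<open>\<open>quotient_map_pi P k\<close> is \<open>\<pi>\<^sub>k\<close>, with values in \<open>\<real>\<^sup>m\<close> for \<open>m = length (P k)\<close>.\<close>

definition quotient_map_pi ::
    "(nat \<Rightarrow> ((nat \<Rightarrow> real) \<times> real_matrix \<Rightarrow> real) list) \<Rightarrow> nat \<Rightarrow>
     (nat \<Rightarrow> real) \<times> real_matrix \<Rightarrow> nat \<Rightarrow> real" where
  "quotient_map_pi P k z = (\<lambda>i. if i < length (P k) then (P k ! i) z else 0)"

definition approx_space ::
    "nat \<Rightarrow> (nat \<Rightarrow> ((nat \<Rightarrow> real) \<times> real_matrix \<Rightarrow> real) list) \<Rightarrow> (nat \<Rightarrow> real) set \<Rightarrow> nat \<Rightarrow>
     (nat \<Rightarrow> real) topology" where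
  "approx_space N P Y k =
     subtopology (Euclidean_space (length (P k))) (quotient_map_pi P k ` (Y \<times> stiefel N k))"

text \<open>The maps \<open>\<pi>\<^sub>k (y, A) \<mapsto> \<pi>\<^sub>k\<^sub>+\<^sub>1 (y, A)\<close> and \<open>\<pi>\<^sub>k (\<Phi> x, A) \<mapsto> [(x, A)]\<close>, which do not depend on the
  representatives chosen by \<^const>\<open>inv_into\<close>.\<close>

definition approx_inclusion ::
    "nat \<Rightarrow> (nat \<Rightarrow> ((nat \<Rightarrow> real) \<times> real_matrix \<Rightarrow> real) list) \<Rightarrow> (nat \<Rightarrow> real) set \<Rightarrow> nat \<Rightarrow>
     (nat \<Rightarrow> real) \<Rightarrow> nat \<Rightarrow> real" where
  "approx_inclusion N P Y k w =
     quotient_map_pi P (Suc k) (inv_into (Y \<times> stiefel N k) (quotient_map_pi P k) w)"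

definition approx_to_borel ::
    "('g, 'b) monoid_scheme \<Rightarrow> nat \<Rightarrow> ('g \<Rightarrow> nat \<Rightarrow> nat) \<Rightarrow> ('g \<Rightarrow> proj_point \<Rightarrow> proj_point) \<Rightarrow>
     proj_point set \<Rightarrow> (proj_point \<Rightarrow> nat \<Rightarrow> real) \<Rightarrow>
     (nat \<Rightarrow> ((nat \<Rightarrow> real) \<times> real_matrix \<Rightarrow> real) list) \<Rightarrow> nat \<Rightarrow>
     (nat \<Rightarrow> real) \<Rightarrow> (proj_point \<times> real_matrix) set" where
  "approx_to_borel G N \<rho> \<alpha> X \<Phi> P k w =
     orbit G (borel_action G N \<rho> \<alpha>)
       (inv_into (X \<times> stiefel N k) (\<lambda>(x, A). quotient_map_pi P k (\<Phi> x, A)) w)"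

end

theory Submission
  imports Defs
begin

text \<open>
  The Borel space \<open>B = (X \<times> V\<^sub>\<infinity>) / G\<close> is exhausted by the images of the stages \<open>X \<times> V\<^sub>k\<close>, where
  \<open>V\<^sub>k\<close> is the Stiefel manifold of \<open>k \<times> N\<close> matrices, and homology has compact supports. Precisely,
  the assertion follows from two facts about the maps \<open>j\<^sub>k\<close> from the \<open>k\<close>-th algebraic quotient to
  \<open>B\<close>, by the general theorem \<open>homology2_direct_limit\<close>.

  Each \<open>j\<^sub>k\<close> is an embedding (\<open>embedding_map_j\<close>). For a point \<open>w\<close>, the product over all \<open>g\<close> in \<open>G\<close> of
  the squared distances from \<open>g \<cdot> z\<close> to \<open>w\<close> is an invariant polynomial in \<open>z\<close>. It vanishes exactly on
  the orbit of \<open>w\<close> and is small only if some \<open>g \<cdot> z\<close> is near \<open>w\<close>. Being a polynomial in the chosen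
  generators, it shows at once that the fibres of \<open>\<pi>\<^sub>k\<close> are the orbits and that \<open>j\<^sub>k\<close> is continuous.
  Moreover \<open>j\<^sub>k\<close> is a closed map, because \<open>V\<^sub>k\<close> is closed in \<open>V\<^sub>\<infinity>\<close> with its own topology as the
  induced one. All this uses that the realization \<open>\<Phi>\<close> of \<open>X\<close> in affine space is a homeomorphism onto
  its image, which holds since regular maps are continuous for the Euclidean topologies.

  Each compact subset of \<open>B\<close> lies in the image of one \<open>j\<^sub>k\<close> (\<open>compactin_borel_space\<close>). The topology of
  \<open>X \<times> V\<^sub>\<infinity>\<close> is a product topology, a priori coarser than that of the union of the \<open>X \<times> V\<^sub>k\<close>, but a
  set of matrices that meets every \<open>V\<^sub>k\<close> in a finite set is closed in \<open>V\<^sub>\<infinity>\<close>, and looking at the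
  second component is enough.
\<close>

section \<open>Direct limits of sequences\<close>

lemma shift_closed:
  assumes "\<And>i a. a \<in> carrier (H i) \<Longrightarrow> f i a \<in> carrier (H (Suc i))" "a \<in> carrier (H i)"
  shows "shift f i m a \<in> carrier (H (i + m))"
  using assms(2) by (induction m) (auto simp: assms(1))

lemma shift_add: "shift f i (m + m') a = shift f (i + m) m' (shift f i m a)"
  by (induction m') (auto simp: add.assoc)

lemma shift_compatible:
  assumes "\<And>i a. a \<in> carrier (H i) \<Longrightarrow> f i a \<in> carrier (H (Suc i))"
    and "\<And>i a. a \<in> carrier (H i) \<Longrightarrow> u (Suc i) (f i a) = u i a" and "a \<in> carrier (H i)"
  shows "u (i + m) (shift f i m a) = u i a"
proof (induction m)
  case (Suc m)
  have "shift f i m a \<in> carrier (H (i + m))" by (rule shift_closed[OF assms(1,3)])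
  with assms(2) Suc show ?case by simp
qed simp

lemma germ_eqI:
  assumes "i + m = j + m'" and "shift f i m a = shift f j m' b"
  shows "germ H f i a = germ H f j b"
proof -
  have sub: "germ H f i a \<subseteq> germ H f j b"
    if eq: "i + m = j + m'" "shift f i m a = shift f j m' b" for i j m m' a b
  proof
    fix x assume "x \<in> germ H f i a"
    then obtain l c n n' where x: "x = (l, c)" "c \<in> carrier (H l)"
      and n: "i + n = l + n'" "shift f i n a = shift f l n' c"
      unfolding germ_def by auto
    have "shift f j (m' + n) b = shift f (i + m) n (shift f i m a)"
      by (simp only: shift_add eq)
    also have "\<dots> = shift f i (n + m) a" by (simp only: shift_add[symmetric] add.commute)
    also have "\<dots> = shift f l (n' + m) c" by (simp only: shift_add n)
    finally have "shift f j (m' + n) b = shift f l (n' + m) c" .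
    moreover have "j + (m' + n) = l + (n' + m)" using eq n by linarith
    ultimately show "x \<in> germ H f j b" unfolding germ_def x using x(2) by blast
  qed
  show ?thesis
    using sub[OF assms] sub[OF assms(1)[symmetric] assms(2)[symmetric]] by blast
qed

lemma germ_self: "a \<in> carrier (H i) \<Longrightarrow> (i, a) \<in> germ H f i a"
  unfolding germ_def by force

text \<open>A compatible family of homomorphisms out of the stages is an isomorphism in the limit if the
  images of the stages exhaust the target and elements of a stage with the same image become equal
  at a later one. The product of two classes is a union over all choices of representatives; that
  these choices agree needs no proof, since compatibility gives all its members the same image.\<close>

theorem direct_limit_map_iso:
  assumes f: "\<And>i a. a \<in> carrier (H i) \<Longrightarrow> f i a \<in> carrier (H (Suc i))"
    and m: "\<And>i a b. a \<in> carrier (H i) \<Longrightarrow> b \<in> carrier (H i) \<Longrightarrow> a \<otimes>\<^bsub>H i\<^esub> b \<in> carrier (H i)"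
    and u: "\<And>i. u i \<in> hom (H i) K"
    and compat: "\<And>i a. a \<in> carrier (H i) \<Longrightarrow> u (Suc i) (f i a) = u i a"
    and onto: "\<And>x. x \<in> carrier K \<Longrightarrow> \<exists>i. \<exists>a\<in>carrier (H i). u i a = x"
    and inj: "\<And>i a b. a \<in> carrier (H i) \<Longrightarrow> b \<in> carrier (H i) \<Longrightarrow> u i a = u i b
                \<Longrightarrow> \<exists>m. shift f i m a = shift f i m b"
  shows "direct_limit_map u \<in> iso (direct_limit H f) K"
proof -
  have shc: "shift f i l a \<in> carrier (H (i + l))" if "a \<in> carrier (H i)" for i l a
    by (rule shift_closed) (use f that in auto)
  have shu: "u (i + l) (shift f i l a) = u i a" if "a \<in> carrier (H i)" for i l a
    by (rule shift_compatible[where H = H]) (use f compat that in auto)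
  have germ_u: "u j b = u i a" if "(j, b) \<in> germ H f i a" "a \<in> carrier (H i)" for i j a b
  proof -
    from that(1) obtain n n' where "b \<in> carrier (H j)" "i + n = j + n'" "shift f i n a = shift f j n' b"
      unfolding germ_def by auto
    then show ?thesis using shu[of b j n'] shu[of a i n] that(2) by metis
  qed
  have const: "direct_limit_map u C = x" if "C \<noteq> {}" "\<And>i a. (i, a) \<in> C \<Longrightarrow> u i a = x" for C x
  proof -
    have "(\<lambda>(i, a). u i a) ` C = {x}" using that by force
    then show ?thesis unfolding direct_limit_map_def by simp
  qed
  have map_germ: "direct_limit_map u (germ H f i a) = u i a" if "a \<in> carrier (H i)" for i a
    by (rule const) (use germ_self[where H = H and i = i and a = a, OF that] germ_u that in blast)+
  show ?thesis
  proof (rule isoI)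
    show "direct_limit_map u \<in> hom (direct_limit H f) K"
    proof (rule homI)
      fix C assume "C \<in> carrier (direct_limit H f)"
      then show "direct_limit_map u C \<in> carrier K"
        using map_germ u by (force simp: direct_limit_def hom_def)
    next
      fix C D assume "C \<in> carrier (direct_limit H f)" "D \<in> carrier (direct_limit H f)"
      then obtain i a j b where C: "C = germ H f i a" "a \<in> carrier (H i)"
        and D: "D = germ H f j b" "b \<in> carrier (H j)"
        by (auto simp: direct_limit_def)
      have prod: "u (i' + j') (shift f i' j' a' \<otimes>\<^bsub>H (i' + j')\<^esub> shift f j' i' b') =
                    u i a \<otimes>\<^bsub>K\<^esub> u j b"
        and closed: "shift f i' j' a' \<otimes>\<^bsub>H (i' + j')\<^esub> shift f j' i' b' \<in> carrier (H (i' + j'))"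
        if "(i', a') \<in> C" "(j', b') \<in> D" for i' j' a' b'
      proof -
        have a': "a' \<in> carrier (H i')" and b': "b' \<in> carrier (H j')"
          using that C D by (auto simp: germ_def)
        have sa: "shift f i' j' a' \<in> carrier (H (i' + j'))" using shc a' by blast
        have sb: "shift f j' i' b' \<in> carrier (H (i' + j'))" using shc[OF b', of i'] by (simp add: add.commute)
        show "shift f i' j' a' \<otimes>\<^bsub>H (i' + j')\<^esub> shift f j' i' b' \<in> carrier (H (i' + j'))"
          by (rule m[OF sa sb])
        have "u (i' + j') (shift f i' j' a') = u i a"
          using shu[OF a', of j'] germ_u that C by metis
        moreover have "u (i' + j') (shift f j' i' b') = u j b"
          using shu[OF b', of i'] germ_u that D by (metis add.commute)
        ultimately show "u (i' + j') (shift f i' j' a' \<otimes>\<^bsub>H (i' + j')\<^esub> shift f j' i' b') =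
                    u i a \<otimes>\<^bsub>K\<^esub> u j b"
          using hom_mult[OF u sa sb] by simp
      qed
      have "direct_limit_map u (C \<otimes>\<^bsub>direct_limit H f\<^esub> D) = u i a \<otimes>\<^bsub>K\<^esub> u j b"
      proof (rule const)
        have "(i, a) \<in> C" "(j, b) \<in> D" using C D germ_self by metis+
        then show "C \<otimes>\<^bsub>direct_limit H f\<^esub> D \<noteq> {}"
          using germ_self[where H = H, OF closed] by (fastforce simp: direct_limit_def)
      next
        fix l c assume "(l, c) \<in> C \<otimes>\<^bsub>direct_limit H f\<^esub> D"
        then obtain i' a' j' b' where "(i', a') \<in> C" "(j', b') \<in> D"
          "(l, c) \<in> germ H f (i' + j') (shift f i' j' a' \<otimes>\<^bsub>H (i' + j')\<^esub> shift f j' i' b')"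
          by (auto simp: direct_limit_def)
        then show "u l c = u i a \<otimes>\<^bsub>K\<^esub> u j b"
          using germ_u closed prod by metis
      qed
      then show "direct_limit_map u (C \<otimes>\<^bsub>direct_limit H f\<^esub> D) =
                   direct_limit_map u C \<otimes>\<^bsub>K\<^esub> direct_limit_map u D"
        using C D map_germ by simp
    qed
  next
    show "bij_betw (direct_limit_map u) (carrier (direct_limit H f)) (carrier K)"
      unfolding bij_betw_def
    proof
      show "inj_on (direct_limit_map u) (carrier (direct_limit H f))"
      proof (rule inj_onI)
        fix C D assume "C \<in> carrier (direct_limit H f)" "D \<in> carrier (direct_limit H f)"
          and eq: "direct_limit_map u C = direct_limit_map u D"
        then obtain i a j b where C: "C = germ H f i a" "a \<in> carrier (H i)"
          and D: "D = germ H f j b" "b \<in> carrier (H j)"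
          by (auto simp: direct_limit_def)
        have sa: "shift f i j a \<in> carrier (H (i + j))" using shc C by blast
        have sb: "shift f j i b \<in> carrier (H (i + j))" using shc[OF D(2), of i] by (simp add: add.commute)
        have "u (i + j) (shift f i j a) = u (i + j) (shift f j i b)"
          using shu[OF C(2), of j] shu[OF D(2), of i] eq map_germ C D by (simp add: add.commute)
        from inj[OF sa sb this] obtain l where
          "shift f (i + j) l (shift f i j a) = shift f (j + i) l (shift f j i b)"
          by (auto simp: add.commute)
        then have "shift f i (j + l) a = shift f j (i + l) b"
          by (simp only: shift_add)
        then show "C = D" unfolding C D by (intro germ_eqI) auto
      qed
      show "direct_limit_map u ` carrier (direct_limit H f) = carrier K"
      proof
        show "direct_limit_map u ` carrier (direct_limit H f) \<subseteq> carrier K"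
          using map_germ u by (force simp: direct_limit_def hom_def)
        show "carrier K \<subseteq> direct_limit_map u ` carrier (direct_limit H f)"
        proof
          fix x assume "x \<in> carrier K"
          then obtain i a where "a \<in> carrier (H i)" "u i a = x" using onto by blast
          then show "x \<in> direct_limit_map u ` carrier (direct_limit H f)"
            using map_germ[of a i] by (force simp: direct_limit_def)
        qed
      qed
    qed
  qed
qed

section \<open>Chains modulo two\<close>

lemma chain2_add_self [simp]: "c + c = 0" for c :: "'a chain2"
  by (rule poly_mapping_eqI) (simp add: lookup_add)

lemma keys_chain2_add:
  "Poly_Mapping.keys (b + c) =
     (Poly_Mapping.keys b - Poly_Mapping.keys c) \<union> (Poly_Mapping.keys c - Poly_Mapping.keys b)"
  for b c :: "'a chain2"
  by (auto simp: in_keys_iff lookup_add)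

text \<open>A sum over the support is additive in the chain: where two supports overlap, the
  coefficients cancel and so do the summands.\<close>

lemma sum_keys_chain2_add:
  fixes b c :: "'a chain2" and g :: "((nat \<Rightarrow> real) \<Rightarrow> 'a) \<Rightarrow> 'b chain2"
  shows "sum g (Poly_Mapping.keys (b + c)) = sum g (Poly_Mapping.keys b) + sum g (Poly_Mapping.keys c)"
proof -
  let ?B = "Poly_Mapping.keys b" and ?C = "Poly_Mapping.keys c"
  have "sum g ?B = sum g (?B - ?C) + sum g (?B \<inter> ?C)"
    by (metis add.commute finite_keys sum.Int_Diff)
  moreover have "sum g ?C = sum g (?C - ?B) + sum g (?B \<inter> ?C)"
    by (metis add.commute finite_keys sum.Int_Diff Int_commute)
  ultimately have "sum g ?B + sum g ?C =
      sum g (?B - ?C) + sum g (?C - ?B) + (sum g (?B \<inter> ?C) + sum g (?B \<inter> ?C))"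
    by (simp only: ac_simps)
  also have "\<dots> = sum g (Poly_Mapping.keys (b + c))"
    unfolding keys_chain2_add chain2_add_self by (subst sum.union_disjoint) auto
  finally show ?thesis ..
qed

lemma chain_map2_add: "chain_map2 p h (b + c) = chain_map2 p h b + chain_map2 p h c"
  unfolding chain_map2_def by (rule sum_keys_chain2_add)

lemma boundary2_add: "boundary2 p (b + c) = boundary2 p b + boundary2 p c"
  using sum_keys_chain2_add unfolding boundary2_def by auto

lemma chain_map2_0 [simp]: "chain_map2 p h 0 = 0"
  by (simp add: chain_map2_def)

lemma boundary2_0 [simp]: "boundary2 p 0 = 0"
  by (simp add: boundary2_def)

lemma chain_map2_sum: "chain_map2 p h (sum g S) = (\<Sum>s\<in>S. chain_map2 p h (g s))"
  by (induction S rule: infinite_finite_induct) (auto simp: chain_map2_add)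

lemma boundary2_sum: "boundary2 p (sum g S) = (\<Sum>s\<in>S. boundary2 p (g s))"
  by (induction S rule: infinite_finite_induct) (auto simp: boundary2_add)

lemma chain_map2_single [simp]:
  "chain_map2 p h (Poly_Mapping.single f 1) = Poly_Mapping.single (simplex_map p h f) 1"
  by (simp add: chain_map2_def)

lemma chain2_expansion: "c = (\<Sum>f\<in>Poly_Mapping.keys c. Poly_Mapping.single f 1)" for c :: "'a chain2"
proof (rule poly_mapping_eqI)
  fix g
  have "(\<Sum>f\<in>Poly_Mapping.keys c. Poly_Mapping.lookup (Poly_Mapping.single f (1::bit)) g) =
      (\<Sum>f\<in>Poly_Mapping.keys c. if f = g then 1 else 0)"
    by (rule sum.cong) (auto simp: lookup_single when_def)
  also have "\<dots> = Poly_Mapping.lookup c g" by (simp add: in_keys_iff)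
  finally show "Poly_Mapping.lookup c g = Poly_Mapping.lookup (\<Sum>f\<in>Poly_Mapping.keys c. Poly_Mapping.single f 1) g"
    by (simp add: lookup_sum)
qed

lemma chains2_single: "singular_simplex p X f \<Longrightarrow> Poly_Mapping.single f 1 \<in> chains2 p X"
  by (simp add: chains2_def)

lemma chains2_0 [simp]: "0 \<in> chains2 p X"
  by (simp add: chains2_def)

lemma chains2_add: "b \<in> chains2 p X \<Longrightarrow> c \<in> chains2 p X \<Longrightarrow> b + c \<in> chains2 p X"
  unfolding chains2_def by (auto simp: keys_chain2_add)

lemma chains2_sum: "(\<And>s. s \<in> S \<Longrightarrow> g s \<in> chains2 p X) \<Longrightarrow> sum g S \<in> chains2 p X"
  by (induction S rule: infinite_finite_induct) (auto intro: chains2_add)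

lemma simplex_in_chain2: "c \<in> chains2 p X \<Longrightarrow> f \<in> Poly_Mapping.keys c \<Longrightarrow> singular_simplex p X f"
  by (auto simp: chains2_def)

lemma chain_map2_chains2:
  assumes "continuous_map X Y h" "c \<in> chains2 p X"
  shows "chain_map2 p h c \<in> chains2 p Y"
  unfolding chain_map2_def
  by (intro chains2_sum chains2_single) (use assms singular_simplex_simplex_map simplex_in_chain2 in blast)

lemma boundary2_chains2:
  assumes "c \<in> chains2 (Suc p) X"
  shows "boundary2 (Suc p) c \<in> chains2 p X"
proof -
  have "singular_simplex p X (singular_face (Suc p) k f)"
    if "f \<in> Poly_Mapping.keys c" "k \<le> Suc p" for f k
    using singular_simplex_singular_face[of "Suc p" X f k] simplex_in_chain2[OF assms] that by simp
  then show ?thesis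
    unfolding boundary2_def by (simp del: sum.atMost_Suc) (intro chains2_sum chains2_single, auto)
qed

lemma singular_face_commutes_simplex_map:
  assumes "k \<le> Suc p"
  shows "singular_face (Suc p) k (simplex_map (Suc p) h f) = simplex_map p h (singular_face (Suc p) k f)"
  using assms by (simp add: singular_face_simplex_map) (simp add: simplex_map_def singular_face_def fun_eq_iff)

lemma boundary2_single:
  "boundary2 (Suc p) (Poly_Mapping.single f 1) = (\<Sum>k\<le>Suc p. Poly_Mapping.single (singular_face (Suc p) k f) 1)"
  by (simp add: boundary2_def)

lemma boundary2_chain_map2: "boundary2 (Suc p) (chain_map2 (Suc p) h c) = chain_map2 p h (boundary2 (Suc p) c)"
proof -
  have "boundary2 (Suc p) (Poly_Mapping.single (simplex_map (Suc p) h f) 1) =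
          chain_map2 p h (boundary2 (Suc p) (Poly_Mapping.single f 1))" for f
    unfolding boundary2_single chain_map2_sum chain_map2_single
    by (rule sum.cong) (auto simp: singular_face_commutes_simplex_map)
  then have "boundary2 (Suc p) (chain_map2 (Suc p) h c) =
      (\<Sum>f\<in>Poly_Mapping.keys c. chain_map2 p h (boundary2 (Suc p) (Poly_Mapping.single f 1)))"
    unfolding chain_map2_def[of "Suc p"] boundary2_sum by simp
  also have "\<dots> = chain_map2 p h (boundary2 (Suc p) (\<Sum>f\<in>Poly_Mapping.keys c. Poly_Mapping.single f 1))"
    by (simp add: boundary2_sum chain_map2_sum)
  also have "(\<Sum>f\<in>Poly_Mapping.keys c. Poly_Mapping.single f 1) = c"
    using chain2_expansion by metis
  finally show ?thesis .
qed

lemma boundary2_chain_map2_cycle: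
  assumes "boundary2 p c = 0"
  shows "boundary2 p (chain_map2 p h c) = 0"
proof (cases p)
  case 0
  then show ?thesis by (simp add: boundary2_def)
next
  case (Suc q)
  then show ?thesis using assms by (simp add: boundary2_chain_map2)
qed

lemma chain_map2_compose:
  assumes "c \<in> chains2 p X" and "\<And>x. x \<in> topspace X \<Longrightarrow> k (h x) = l x"
  shows "chain_map2 p k (chain_map2 p h c) = chain_map2 p l c"
proof -
  have "simplex_map p k (simplex_map p h f) = simplex_map p l f" if "f \<in> Poly_Mapping.keys c" for f
  proof -
    have "simplex_map p k (simplex_map p h f) = simplex_map p (k \<circ> h) f"
      by (simp add: simplex_map_def fun_eq_iff)
    also have "\<dots> = simplex_map p l f"
      by (rule simplex_map_eq[OF simplex_in_chain2[OF assms(1) that]]) (simp add: assms(2))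
    finally show ?thesis .
  qed
  then show ?thesis
    by (simp add: chain_map2_def[of p h] chain_map2_def[of p l] chain_map2_sum)
qed

lemma chain_map2_id:
  assumes "c \<in> chains2 p X" and "\<And>x. x \<in> topspace X \<Longrightarrow> h x = x"
  shows "chain_map2 p h c = c"
proof -
  have "chain_map2 p h c = (\<Sum>f\<in>Poly_Mapping.keys c. Poly_Mapping.single f 1)"
    unfolding chain_map2_def
    by (rule sum.cong) (use simplex_map_id_gen[OF simplex_in_chain2[OF assms(1)] assms(2)] in auto)
  then show ?thesis using chain2_expansion by metis
qed

section \<open>Homology classes\<close>

definition hclass2 :: "nat \<Rightarrow> 'a topology \<Rightarrow> 'a chain2 \<Rightarrow> 'a chain2 set" where
  "hclass2 p X c = boundaries2 p X #>\<^bsub>cycles2 p X\<^esub> c"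

lemma mem_hclass2: "x \<in> hclass2 p X c \<longleftrightarrow> (\<exists>b\<in>boundaries2 p X. x = b + c)"
  by (auto simp: hclass2_def r_coset_def cycles2_def)

lemma boundaries2_0: "0 \<in> boundaries2 p X"
  unfolding boundaries2_def by (rule image_eqI[of _ _ 0]) auto

lemma boundaries2_add: "b \<in> boundaries2 p X \<Longrightarrow> c \<in> boundaries2 p X \<Longrightarrow> b + c \<in> boundaries2 p X"
  unfolding boundaries2_def by (elim imageE, simp only: boundary2_add[symmetric]) (intro imageI chains2_add)

lemma hclass2_eq_iff: "hclass2 p X b = hclass2 p X c \<longleftrightarrow> b + c \<in> boundaries2 p X"
proof
  assume "hclass2 p X b = hclass2 p X c"
  moreover have "b \<in> hclass2 p X b" unfolding mem_hclass2 by (rule bexI[OF _ boundaries2_0]) simp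
  ultimately obtain d where "d \<in> boundaries2 p X" "b = d + c" using mem_hclass2 by blast
  then have "b + c = d" by (simp only: add.assoc chain2_add_self add_0_right)
  then show "b + c \<in> boundaries2 p X" using \<open>d \<in> boundaries2 p X\<close> by (simp only:)
next
  assume bc: "b + c \<in> boundaries2 p X"
  have sub: "hclass2 p X b \<subseteq> hclass2 p X c" if bc: "b + c \<in> boundaries2 p X" for b c
  proof
    fix x assume "x \<in> hclass2 p X b"
    then obtain d where d: "d \<in> boundaries2 p X" "x = d + b" using mem_hclass2 by blast
    then have "x = (d + (b + c)) + c" by (simp only: add.assoc chain2_add_self add_0_right)
    then show "x \<in> hclass2 p X c" using boundaries2_add[OF d(1) bc] mem_hclass2 by blast
  qed
  show "hclass2 p X b = hclass2 p X c"
    using sub[of b c] sub[of c b] bc by (simp only: add.commute[of c b] subset_antisym)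
qed

lemma carrier_homology2: "carrier (homology2 p X) = hclass2 p X ` {c \<in> chains2 p X. boundary2 p c = 0}"
  unfolding homology2_def FactGroup_def RCOSETS_def hclass2_def cycles2_def
  by (simp only: monoid.simps partial_object.simps) blast

lemma homology2E:
  assumes "C \<in> carrier (homology2 p X)"
  obtains c where "C = hclass2 p X c" "c \<in> chains2 p X" "boundary2 p c = 0"
  using assms by (auto simp: carrier_homology2)

lemma homology2I: "c \<in> chains2 p X \<Longrightarrow> boundary2 p c = 0 \<Longrightarrow> hclass2 p X c \<in> carrier (homology2 p X)"
  by (auto simp: carrier_homology2)

lemma homology2_mult: "hclass2 p X b \<otimes>\<^bsub>homology2 p X\<^esub> hclass2 p X c = hclass2 p X (b + c)"
proof -
  have "hclass2 p X b \<otimes>\<^bsub>homology2 p X\<^esub> hclass2 p X c = {x + y | x y. x \<in> hclass2 p X b \<and> y \<in> hclass2 p X c}"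
    unfolding homology2_def FactGroup_def set_mult_def cycles2_def by (simp only: monoid.simps partial_object.simps) blast
  also have "\<dots> = hclass2 p X (b + c)"
  proof (intro subset_antisym subsetI)
    fix z assume "z \<in> {x + y | x y. x \<in> hclass2 p X b \<and> y \<in> hclass2 p X c}"
    then obtain d e where d: "d \<in> boundaries2 p X" and e: "e \<in> boundaries2 p X"
      and z: "z = (d + b) + (e + c)"
      unfolding mem_hclass2 by blast
    have "z = (d + e) + (b + c)" unfolding z by (simp only: ac_simps)
    then show "z \<in> hclass2 p X (b + c)"
      unfolding mem_hclass2 using boundaries2_add[OF d e] by blast
  next
    fix z assume "z \<in> hclass2 p X (b + c)"
    then obtain d where d: "d \<in> boundaries2 p X" "z = (d + b) + (0 + c)"
      unfolding mem_hclass2 by (metis add.assoc add_0)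
    then show "z \<in> {x + y | x y. x \<in> hclass2 p X b \<and> y \<in> hclass2 p X c}"
      unfolding mem_hclass2 using boundaries2_0 by blast
  qed
  finally show ?thesis .
qed

lemma homology2_mult_closed:
  "C \<in> carrier (homology2 p X) \<Longrightarrow> D \<in> carrier (homology2 p X) \<Longrightarrow> C \<otimes>\<^bsub>homology2 p X\<^esub> D \<in> carrier (homology2 p X)"
proof -
  assume C: "C \<in> carrier (homology2 p X)" and D: "D \<in> carrier (homology2 p X)"
  from C obtain b where b: "C = hclass2 p X b" "b \<in> chains2 p X" "boundary2 p b = 0" by (rule homology2E)
  from D obtain c where c: "D = hclass2 p X c" "c \<in> chains2 p X" "boundary2 p c = 0" by (rule homology2E)
  have "boundary2 p (b + c) = 0" unfolding boundary2_add b(3) c(3) by (rule chain2_add_self)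
  then show ?thesis
    unfolding b(1) c(1) homology2_mult by (rule homology2I[OF chains2_add[OF b(2) c(2)]])
qed

text \<open>The definition of \<^const>\<open>hom_induced2\<close> is a union over all representatives; their images are
  homologous since a chain map takes boundaries to boundaries.\<close>

lemma hom_induced2_hclass2:
  assumes "continuous_map X Y h"
  shows "hom_induced2 p Y h (hclass2 p X c) = hclass2 p Y (chain_map2 p h c)"
proof -
  have "hclass2 p Y (chain_map2 p h (b + c)) = hclass2 p Y (chain_map2 p h c)" if "b \<in> boundaries2 p X" for b
  proof -
    obtain e where "e \<in> chains2 (Suc p) X" "b = boundary2 (Suc p) e"
      using \<open>b \<in> boundaries2 p X\<close> unfolding boundaries2_def by blast
    then have "chain_map2 p h b = boundary2 (Suc p) (chain_map2 (Suc p) h e)"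
      "chain_map2 (Suc p) h e \<in> chains2 (Suc p) Y"
      using chain_map2_chains2[OF assms] boundary2_chain_map2 by metis+
    then have "chain_map2 p h b \<in> boundaries2 p Y"
      unfolding boundaries2_def by (rule image_eqI)
    then show ?thesis by (simp add: hclass2_eq_iff chain_map2_add add.assoc)
  qed
  moreover have "0 + c \<in> hclass2 p X c" using boundaries2_0 mem_hclass2 by blast
  moreover have "hom_induced2 p Y h (hclass2 p X c) = (\<Union>x\<in>hclass2 p X c. hclass2 p Y (chain_map2 p h x))"
    by (simp add: hom_induced2_def hclass2_def)
  ultimately show ?thesis using mem_hclass2[of _ p X c] by force
qed

lemma hom_induced2_hom:
  assumes "continuous_map X Y h"
  shows "hom_induced2 p Y h \<in> hom (homology2 p X) (homology2 p Y)"
proof (rule homI)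
  fix C assume "C \<in> carrier (homology2 p X)"
  then obtain c where c: "C = hclass2 p X c" "c \<in> chains2 p X" "boundary2 p c = 0" by (rule homology2E)
  show "hom_induced2 p Y h C \<in> carrier (homology2 p Y)"
    unfolding c(1) hom_induced2_hclass2[OF assms]
    by (rule homology2I) (use c assms chain_map2_chains2 boundary2_chain_map2_cycle in blast)+
  fix D assume "D \<in> carrier (homology2 p X)"
  then obtain d where d: "D = hclass2 p X d" by (rule homology2E)
  show "hom_induced2 p Y h (C \<otimes>\<^bsub>homology2 p X\<^esub> D) =
      hom_induced2 p Y h C \<otimes>\<^bsub>homology2 p Y\<^esub> hom_induced2 p Y h D"
    unfolding c(1) d homology2_mult hom_induced2_hclass2[OF assms] chain_map2_add ..
qed

section \<open>Homology of a space exhausted by embedded subspaces\<close>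

text \<open>A chain involves finitely many simplices, each with compact image, so every chain of \<open>B\<close>
  comes from a chain of some stage, which is unique in that stage as the stage is embedded. Lifting cycles
  in this way gives surjectivity; lifting a chain that bounds the image of a cycle gives
  injectivity.\<close>

theorem homology2_direct_limit:
  fixes S :: "nat \<Rightarrow> 'a topology" and B :: "'b topology"
  assumes emb: "\<And>k. embedding_map (S k) B (j k)"
    and inc: "\<And>k x. x \<in> topspace (S k) \<Longrightarrow> i k x \<in> topspace (S (Suc k))"
    and comm: "\<And>k x. x \<in> topspace (S k) \<Longrightarrow> j (Suc k) (i k x) = j k x"
    and compact: "\<And>K. compactin B K \<Longrightarrow> \<exists>k. K \<subseteq> j k ` topspace (S k)"
  shows "direct_limit_map (\<lambda>k. hom_induced2 p B (j k)) \<in>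
     iso (direct_limit (\<lambda>k. homology2 p (S k)) (\<lambda>k. hom_induced2 p (S (Suc k)) (i k))) (homology2 p B)"
proof -
  have homeo: "homeomorphic_map (S k) (subtopology B (j k ` topspace (S k))) (j k)" for k
    using emb by (simp add: embedding_map_def)
  have top_j: "topspace (subtopology B (j k ` topspace (S k))) = j k ` topspace (S k)" for k
    using homeomorphic_imp_surjective_map[OF homeo] by metis
  have cj: "continuous_map (S k) B (j k)" for k
    using homeomorphic_imp_continuous_map[OF homeo] continuous_map_in_subtopology by blast
  have "\<exists>r. homeomorphic_maps (S k) (subtopology B (j k ` topspace (S k))) (j k) r" for k
    using homeo homeomorphic_map_maps by blast
  then obtain r where r: "\<And>k. homeomorphic_maps (S k) (subtopology B (j k ` topspace (S k))) (j k) (r k)"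
    by metis
  have cr: "continuous_map (subtopology B (j k ` topspace (S k))) (S k) (r k)"
    and rj: "x \<in> topspace (S k) \<Longrightarrow> r k (j k x) = x" for k x
    using r[of k] by (auto simp: homeomorphic_maps_def)
  have jr: "x \<in> j k ` topspace (S k) \<Longrightarrow> j k (r k x) = x" for k x
    using rj by auto
  have mono: "j k ` topspace (S k) \<subseteq> j (k + m) ` topspace (S (k + m))" for k m
  proof (induction m)
    case (Suc m)
    have "j (k + m) ` topspace (S (k + m)) \<subseteq> j (Suc (k + m)) ` topspace (S (Suc (k + m)))"
      using inc comm by (metis image_subset_iff rev_image_eqI)
    then show ?case using Suc by auto
  qed auto
  have ci: "continuous_map (S k) (S (Suc k)) (i k)" for k
  proof -
    have "continuous_map (S k) (subtopology B (j (Suc k) ` topspace (S (Suc k)))) (j k)"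
      using cj[of k] mono[of k 1] by (simp add: continuous_map_in_subtopology image_subset_iff_funcset[symmetric])
    then have "continuous_map (S k) (S (Suc k)) (r (Suc k) \<circ> j k)"
      using cr continuous_map_compose by blast
    then show ?thesis
      by (rule continuous_map_eq) (metis comm comp_apply inc rj)
  qed
  have compact_chain: "\<exists>k. \<forall>f\<in>Poly_Mapping.keys c. f ` standard_simplex q \<subseteq> j k ` topspace (S k)"
    if "c \<in> chains2 q B" for q c
  proof -
    have "compactin B (f ` standard_simplex q)" if "f \<in> Poly_Mapping.keys c" for f
    proof -
      have "continuous_map (subtopology (powertop_real UNIV) (standard_simplex q)) B f"
        using simplex_in_chain2[OF \<open>c \<in> chains2 q B\<close> that] by (simp add: singular_simplex_def)
      moreover have "compactin (subtopology (powertop_real UNIV) (standard_simplex q)) (standard_simplex q)"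
        using compactin_standard_simplex by (simp add: compactin_subtopology)
      ultimately show ?thesis using image_compactin by blast
    qed
    then have "compactin B (\<Union>f\<in>Poly_Mapping.keys c. f ` standard_simplex q)"
      by (intro compactin_Union) auto
    from compact[OF this] show ?thesis by (simp add: UN_subset_iff)
  qed
  have lift: "\<exists>c'\<in>chains2 q (S (k + m)). chain_map2 q (j (k + m)) c' = c"
    if "\<forall>f\<in>Poly_Mapping.keys c. f ` standard_simplex q \<subseteq> j k ` topspace (S k)" and c: "c \<in> chains2 q B"
    for q c k m
  proof
    let ?U = "subtopology B (j (k + m) ` topspace (S (k + m)))"
    have "c \<in> chains2 q ?U"
      unfolding chains2_def using that(1) simplex_in_chain2[OF c] mono[of k m]
      by (fastforce simp: singular_simplex_subtopology)
    then show "chain_map2 q (r (k + m)) c \<in> chains2 q (S (k + m))"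
      using cr chain_map2_chains2 by blast
    have "chain_map2 q (j (k + m)) (chain_map2 q (r (k + m)) c) = chain_map2 q (\<lambda>x. x) c"
      by (rule chain_map2_compose[OF \<open>c \<in> chains2 q ?U\<close>]) (simp add: jr)
    also have "\<dots> = c" by (rule chain_map2_id[OF c]) simp
    finally show "chain_map2 q (j (k + m)) (chain_map2 q (r (k + m)) c) = c" .
  qed
  have chain_inj: "b = c" if "b \<in> chains2 q (S k)" "c \<in> chains2 q (S k)"
    "chain_map2 q (j k) b = chain_map2 q (j k) c" for q k b c
  proof -
    have "chain_map2 q (r k) (chain_map2 q (j k) c) = c" if "c \<in> chains2 q (S k)" for c
      using chain_map2_compose[OF that, of "r k" "j k" "\<lambda>x. x"] chain_map2_id[OF that, of "\<lambda>x. x"] rj by simp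
    then show ?thesis using that by metis
  qed
  let ?f = "\<lambda>k. hom_induced2 p (S (Suc k)) (i k)"
  \<comment> \<open>In place of a formula for the iterated bonding map, only the image in \<open>B\<close> is recorded: it
    determines the chain.\<close>
  have shift: "\<exists>c'\<in>chains2 p (S (k + m)). shift ?f k m (hclass2 p (S k) c) = hclass2 p (S (k + m)) c' \<and>
       chain_map2 p (j (k + m)) c' = chain_map2 p (j k) c"
    if "c \<in> chains2 p (S k)" for k m c
  proof (induction m)
    case (Suc m)
    then obtain c' where c': "c' \<in> chains2 p (S (k + m))"
      "shift ?f k m (hclass2 p (S k) c) = hclass2 p (S (k + m)) c'"
      "chain_map2 p (j (k + m)) c' = chain_map2 p (j k) c" by blast
    show ?case
    proof (intro bexI conjI)
      show "chain_map2 p (i (k + m)) c' \<in> chains2 p (S (k + Suc m))"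
        using chain_map2_chains2[OF ci c'(1)] by simp
      show "shift ?f k (Suc m) (hclass2 p (S k) c) =
          hclass2 p (S (k + Suc m)) (chain_map2 p (i (k + m)) c')"
        using hom_induced2_hclass2[OF ci] c'(2) by simp
      show "chain_map2 p (j (k + Suc m)) (chain_map2 p (i (k + m)) c') = chain_map2 p (j k) c"
        using chain_map2_compose[OF c'(1), of "j (Suc (k + m))" "i (k + m)" "j (k + m)"] comm c'(3) by simp
    qed
  qed (use that in auto)
  show ?thesis
  proof (rule direct_limit_map_iso)
    show "?f k C \<in> carrier (homology2 p (S (Suc k)))" if "C \<in> carrier (homology2 p (S k))" for k C
      using hom_induced2_hom[OF ci] that by (auto simp: hom_def)
    show "hom_induced2 p B (j k) \<in> hom (homology2 p (S k)) (homology2 p B)" for k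
      by (rule hom_induced2_hom[OF cj])
    show "hom_induced2 p B (j (Suc k)) (?f k C) = hom_induced2 p B (j k) C"
      if "C \<in> carrier (homology2 p (S k))" for k C
    proof -
      from that obtain c where c: "C = hclass2 p (S k) c" "c \<in> chains2 p (S k)" by (rule homology2E)
      show ?thesis
        unfolding c(1) hom_induced2_hclass2[OF ci] hom_induced2_hclass2[OF cj]
        using chain_map2_compose[OF c(2), of "j (Suc k)" "i k" "j k"] comm by simp
    qed
    show "\<exists>k. \<exists>C'\<in>carrier (homology2 p (S k)). hom_induced2 p B (j k) C' = C"
      if C: "C \<in> carrier (homology2 p B)" for C
    proof -
      from C obtain c where c: "C = hclass2 p B c" "c \<in> chains2 p B" "boundary2 p c = 0" by (rule homology2E)
      from compact_chain[OF c(2)] obtain k where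
        "\<forall>f\<in>Poly_Mapping.keys c. f ` standard_simplex p \<subseteq> j k ` topspace (S k)" by blast
      from lift[OF this c(2), of 0] obtain c' where c': "c' \<in> chains2 p (S k)" "chain_map2 p (j k) c' = c"
        by auto
      have "boundary2 p c' = 0"
      proof (cases p)
        case (Suc q)
        have "chain_map2 q (j k) (boundary2 p c') = 0"
          using c(3) c'(2) by (simp add: Suc boundary2_chain_map2[symmetric])
        moreover have "boundary2 p c' \<in> chains2 q (S k)"
          using boundary2_chains2 c'(1) Suc by blast
        ultimately show ?thesis
          using chain_inj[of "boundary2 p c'" q k 0] by simp
      qed (simp add: boundary2_def)
      then show ?thesis
        using homology2I[OF c'(1)] hom_induced2_hclass2[OF cj] c' c(1) by metis
    qed
    show "\<exists>m. shift ?f k m C = shift ?f k m D"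
      if C: "C \<in> carrier (homology2 p (S k))" and D: "D \<in> carrier (homology2 p (S k))"
        and eq: "hom_induced2 p B (j k) C = hom_induced2 p B (j k) D" for k C D
    proof -
      obtain c where c: "C = hclass2 p (S k) c" "c \<in> chains2 p (S k)" using C by (rule homology2E)
      obtain d where d: "D = hclass2 p (S k) d" "d \<in> chains2 p (S k)" using D by (rule homology2E)
      have "chain_map2 p (j k) (c + d) \<in> boundaries2 p B"
        using eq by (simp add: c(1) d(1) hom_induced2_hclass2[OF cj] hclass2_eq_iff chain_map2_add)
      then obtain e where e: "e \<in> chains2 (Suc p) B" "boundary2 (Suc p) e = chain_map2 p (j k) (c + d)"
        by (auto simp: boundaries2_def)
      from compact_chain[OF e(1)] obtain l where
        "\<forall>f\<in>Poly_Mapping.keys e. f ` standard_simplex (Suc p) \<subseteq> j l ` topspace (S l)" by blast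
      from lift[OF this e(1), of k] obtain e' where
        e': "e' \<in> chains2 (Suc p) (S (k + l))" "chain_map2 (Suc p) (j (k + l)) e' = e"
        by (auto simp: add.commute)
      from shift[OF c(2), of l] obtain c' where c': "c' \<in> chains2 p (S (k + l))"
        "shift ?f k l C = hclass2 p (S (k + l)) c'" "chain_map2 p (j (k + l)) c' = chain_map2 p (j k) c"
        unfolding c(1) by blast
      from shift[OF d(2), of l] obtain d' where d': "d' \<in> chains2 p (S (k + l))"
        "shift ?f k l D = hclass2 p (S (k + l)) d'" "chain_map2 p (j (k + l)) d' = chain_map2 p (j k) d"
        unfolding d(1) by blast
      have "chain_map2 p (j (k + l)) (boundary2 (Suc p) e') = chain_map2 p (j (k + l)) (c' + d')"
        using e(2) by (simp add: boundary2_chain_map2[symmetric] e'(2) chain_map2_add c'(3) d'(3))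
      then have "boundary2 (Suc p) e' = c' + d'"
        using chain_inj boundary2_chains2[OF e'(1)] chains2_add[OF c'(1) d'(1)] by blast
      then have "c' + d' \<in> boundaries2 p (S (k + l))"
        unfolding boundaries2_def by (rule image_eqI[OF sym e'(1)])
      then have "shift ?f k l C = shift ?f k l D"
        by (simp add: c'(2) d'(2) hclass2_eq_iff)
      then show ?thesis ..
    qed
  qed (rule homology2_mult_closed)
qed

section \<open>Topology of projective space\<close>

lemma topspace_quotient_topology [simp]: "topspace (quotient_topology T q) = q ` topspace T"
proof
  show "topspace (quotient_topology T q) \<subseteq> q ` topspace T"
    using openin_topspace openin_quotient_topology by metis
  have "{x \<in> topspace T. q x \<in> q ` topspace T} = topspace T" by auto
  then have "openin (quotient_topology T q) (q ` topspace T)"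
    by (simp add: openin_quotient_topology)
  then show "q ` topspace T \<subseteq> topspace (quotient_topology T q)" by (rule openin_subset)
qed

lemma quotient_map_quotient_topology: "quotient_map T (quotient_topology T q) q"
  by (auto simp: quotient_map_def openin_quotient_topology)

lemma continuous_on_generated_algebra:
  assumes "f \<in> generated_algebra S" "\<And>s. s \<in> S \<Longrightarrow> continuous_on A s"
  shows "continuous_on A f"
  using assms by induction (auto intro: continuous_intros)

lemma continuous_on_polynomials: "F \<in> polynomials n \<Longrightarrow> continuous_on A F"
  unfolding polynomials_def
  by (erule continuous_on_generated_algebra)
    (auto intro: continuous_on_subset[OF continuous_on_product_coordinates])

lemma subtopology_Euclidean_space:
  "A \<subseteq> topspace (Euclidean_space n) \<Longrightarrow> subtopology (Euclidean_space n) A = top_of_set A"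
  unfolding Euclidean_space_def subtopology_subtopology euclidean_product_topology
  by (simp add: inf.absorb2)

lemma proj_pt_scale: "c \<noteq> 0 \<Longrightarrow> proj_pt (\<lambda>i. c * v i) = proj_pt v"
proof -
  assume c: "c \<noteq> 0"
  have "\<exists>b. b \<noteq> 0 \<and> (\<lambda>i. a * v i) = (\<lambda>i. b * (c * v i))" if "a \<noteq> 0" for a
    using that c by (intro exI[of _ "a / c"]) auto
  moreover have "\<exists>b. b \<noteq> 0 \<and> (\<lambda>i. a * (c * v i)) = (\<lambda>i. b * v i)" if "a \<noteq> 0" for a
    using that c by (intro exI[of _ "a * c"]) auto
  ultimately show ?thesis unfolding proj_pt_def by blast
qed

lemma proj_pt_self: "v \<in> proj_pt v"
  unfolding proj_pt_def by (rule CollectI, rule exI[of _ 1]) auto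

lemma proj_pt_eqE:
  assumes "proj_pt v = proj_pt w"
  obtains c where "c \<noteq> 0" "v = (\<lambda>i. c * w i)"
  using assms proj_pt_self[of v] unfolding proj_pt_def by auto

lemma nonzero_vectors_scale: "c \<noteq> 0 \<Longrightarrow> v \<in> nonzero_vectors n \<Longrightarrow> (\<lambda>i. c * v i) \<in> nonzero_vectors n"
  by (auto simp: nonzero_vectors_def topspace_Euclidean_space fun_eq_iff)

lemma proj_topology_eq: "proj_topology n = quotient_topology (top_of_set (nonzero_vectors (Suc n))) proj_pt"
  unfolding proj_topology_def by (subst subtopology_Euclidean_space) (auto simp: nonzero_vectors_def)

lemma topspace_proj_topology [simp]: "topspace (proj_topology n) = proj_space n"
  by (simp add: proj_topology_eq proj_space_def)

lemma continuous_on_scale: "continuous_on A (\<lambda>v i. c * v i)" for c :: real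
  by (intro continuous_intros continuous_on_subset[OF continuous_on_product_coordinates]) auto

text \<open>The saturation of an open set of vectors is the union of its nonzero multiples.\<close>

lemma open_map_proj_pt: "open_map (top_of_set (nonzero_vectors (Suc n))) (proj_topology n) proj_pt"
  unfolding open_map_def
proof (intro allI impI)
  let ?V = "nonzero_vectors (Suc n)"
  fix U assume U: "openin (top_of_set ?V) U"
  then have sub: "U \<subseteq> ?V" using openin_imp_subset by blast
  have "openin (top_of_set ?V) {v \<in> ?V. (\<lambda>i. c * v i) \<in> U}" if "c \<noteq> 0" for c
  proof -
    have "openin (top_of_set ?V) (?V \<inter> (\<lambda>v i. c * v i) -` U)"
      by (rule continuous_openin_preimage[OF continuous_on_scale _ U]) (use nonzero_vectors_scale that in auto)
    then show ?thesis by (simp add: vimage_def Int_def)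
  qed
  then have "openin (top_of_set ?V) (\<Union>c\<in>-{0}. {v \<in> ?V. (\<lambda>i. c * v i) \<in> U})"
    by (intro openin_Union) auto
  moreover have "(\<Union>c\<in>-{0}. {v \<in> ?V. (\<lambda>i. c * v i) \<in> U}) = {v \<in> ?V. proj_pt v \<in> proj_pt ` U}"
  proof (intro subset_antisym subsetI)
    fix v assume "v \<in> (\<Union>c\<in>-{0}. {v \<in> ?V. (\<lambda>i. c * v i) \<in> U})"
    then obtain c where "c \<noteq> 0" "v \<in> ?V" "(\<lambda>i. c * v i) \<in> U" by auto
    then show "v \<in> {v \<in> ?V. proj_pt v \<in> proj_pt ` U}"
      using proj_pt_scale[of c v] by (metis (mono_tags, lifting) imageI mem_Collect_eq)
  next
    fix v assume "v \<in> {v \<in> ?V. proj_pt v \<in> proj_pt ` U}"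
    then obtain w where w: "v \<in> ?V" "w \<in> U" "proj_pt w = proj_pt v" by auto
    from w(3) obtain c where "c \<noteq> 0" "w = (\<lambda>i. c * v i)" by (rule proj_pt_eqE)
    then show "v \<in> (\<Union>c\<in>-{0}. {v \<in> ?V. (\<lambda>i. c * v i) \<in> U})" using w by blast
  qed
  ultimately show "openin (proj_topology n) (proj_pt ` U)"
    using sub by (simp add: proj_topology_eq openin_quotient_topology image_mono)
qed

lemma continuous_map_proj_pt: "continuous_map (top_of_set (nonzero_vectors (Suc n))) (proj_topology n) proj_pt"
  unfolding proj_topology_eq by (rule quotient_imp_continuous_map[OF quotient_map_quotient_topology])

text \<open>An open quotient map remains a quotient map over every subset of the target, so continuity on
  any set of projective points may be tested on the cone over it.\<close>

lemma continuous_map_from_proj: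
  assumes S: "S \<subseteq> proj_space n"
    and f: "continuous_map (top_of_set {v \<in> nonzero_vectors (Suc n). proj_pt v \<in> S}) Y (f \<circ> proj_pt)"
  shows "continuous_map (subtopology (proj_topology n) S) Y f"
proof -
  let ?U = "{v \<in> nonzero_vectors (Suc n). proj_pt v \<in> S}"
  have sub: "subtopology (top_of_set (nonzero_vectors (Suc n))) ?U = top_of_set ?U"
    by (simp add: subtopology_subtopology inf.absorb2)
  have "quotient_map (top_of_set ?U) (subtopology (proj_topology n) S) proj_pt"
  proof (rule continuous_open_imp_quotient_map)
    show "open_map (top_of_set ?U) (subtopology (proj_topology n) S) proj_pt"
      using open_map_restriction[OF open_map_proj_pt, of n S] by (simp add: sub)
    show "continuous_map (top_of_set ?U) (subtopology (proj_topology n) S) proj_pt"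
      using continuous_map_from_subtopology[OF continuous_map_proj_pt, of n ?U]
      by (simp add: sub continuous_map_in_subtopology)
    show "proj_pt ` topspace (top_of_set ?U) = topspace (subtopology (proj_topology n) S)"
      using S by (auto simp: proj_space_def)
  qed
  then show ?thesis using continuous_compose_quotient_map f by blast
qed

text \<open>By homogeneity the cone over a Zariski closed set is the set of common zeros of the forms, and
  these are continuous.\<close>

lemma openin_zariski_complement:
  assumes "zariski_closed n Z"
  shows "openin (top_of_set (nonzero_vectors (Suc n))) {v \<in> nonzero_vectors (Suc n). proj_pt v \<notin> Z}"
proof -
  let ?V = "nonzero_vectors (Suc n)"
  obtain S where S: "S \<subseteq> (\<Union>e. forms (Suc n) e)" and Z: "Z = proj_pt ` {v \<in> ?V. \<forall>F\<in>S. F v = 0}"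
    using assms unfolding zariski_closed_def by blast
  have "closed (\<Inter>F\<in>S. {v. F v = 0})"
    using S by (intro closed_INT ballI closed_Collect_eq continuous_on_polynomials[of _ "Suc n"]
      continuous_on_const) (auto simp: forms_def)
  moreover have "{v \<in> ?V. proj_pt v \<notin> Z} = ?V \<inter> - (\<Inter>F\<in>S. {v. F v = 0})"
  proof (intro subset_antisym subsetI)
    fix v assume "v \<in> {v \<in> ?V. proj_pt v \<notin> Z}"
    then show "v \<in> ?V \<inter> - (\<Inter>F\<in>S. {v. F v = 0})" unfolding Z by auto
  next
    fix v assume v: "v \<in> ?V \<inter> - (\<Inter>F\<in>S. {v. F v = 0})"
    have "proj_pt v \<notin> Z"
    proof
      assume "proj_pt v \<in> Z"
      then obtain w where w: "proj_pt v = proj_pt w" "\<forall>F\<in>S. F w = 0" unfolding Z by auto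
      from w(1) obtain c where c: "v = (\<lambda>i. c * w i)" by (rule proj_pt_eqE)
      have "F v = 0" if F: "F \<in> S" for F
      proof -
        obtain e where "F \<in> forms (Suc n) e" using S F by blast
        then have "F v = c ^ e * F w" unfolding c by (simp add: forms_def)
        then show ?thesis using w(2) F by simp
      qed
      then show False using v by blast
    qed
    then show "v \<in> {v \<in> ?V. proj_pt v \<notin> Z}" using v by blast
  qed
  ultimately show ?thesis by (auto simp: openin_open intro!: exI[of _ "- (\<Inter>F\<in>S. {v. F v = 0})"])
qed

lemma zariski_closure_subset: "X \<subseteq> proj_space n \<Longrightarrow> zariski_closure n X \<subseteq> proj_space n"
proof -
  assume X: "X \<subseteq> proj_space n"
  have "zariski_closed n (proj_space n)"
    unfolding zariski_closed_def proj_space_def by (rule exI[of _ "{}"]) simp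
  then show ?thesis using X unfolding zariski_closure_def by blast
qed

lemma subset_zariski_closure: "X \<subseteq> zariski_closure n X"
  unfolding zariski_closure_def by blast

lemma AS_sets_subset:
  assumes "X \<in> AS_sets n"
  shows "X \<subseteq> proj_space n"
proof -
  have "X \<in> boolean_combinations (proj_space n) (arc_symmetric_sets n)"
    using assms by (simp add: AS_sets_def)
  then show ?thesis by induction (auto simp: arc_symmetric_sets_def)
qed

text \<open>Near a given vector a regular map is covered by a tuple of forms without common zero, a
  continuous map between spaces of vectors; the vectors where this representation is valid form an
  open set.\<close>

lemma continuous_map_regular_map:
  assumes f: "regular_map n S m T f" and S: "S \<subseteq> proj_space n"
  shows "continuous_map (subtopology (proj_topology n) S) (proj_topology m) f"
proof (rule continuous_map_from_proj[OF S])
  let ?V = "nonzero_vectors (Suc n)" and ?W = "nonzero_vectors (Suc m)"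
  let ?U = "{v \<in> ?V. proj_pt v \<in> S}"
  have local: "\<exists>D F. openin (top_of_set ?U) D \<and> v0 \<in> D \<and> continuous_on UNIV F \<and>
      (\<forall>v\<in>D. F v \<in> ?W \<and> f (proj_pt v) = proj_pt (F v))" if v0: "v0 \<in> ?U" for v0
  proof -
    from bspec[OF conjunct2[OF f[unfolded regular_map_def]], of "proj_pt v0"] v0
    obtain Z e F where reg: "zariski_closed n Z \<and> proj_pt v0 \<notin> Z \<and> (\<forall>i\<le>m. F i \<in> forms (Suc n) e) \<and>
        (\<forall>v\<in>?V. proj_pt v \<in> S - Z \<longrightarrow>
           (\<exists>i\<le>m. F i v \<noteq> 0) \<and> f (proj_pt v) = proj_pt (\<lambda>i. if i \<le> m then F i v else 0))"
      by (elim CollectE conjE) (erule meta_impE, assumption, elim exE)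
    then have Z: "zariski_closed n Z" "proj_pt v0 \<notin> Z"
      and F: "\<And>i. i \<le> m \<Longrightarrow> F i \<in> forms (Suc n) e"
      and nz: "\<And>v. v \<in> ?V \<Longrightarrow> proj_pt v \<in> S - Z \<Longrightarrow> \<exists>i\<le>m. F i v \<noteq> 0"
      and fv: "\<And>v. v \<in> ?V \<Longrightarrow> proj_pt v \<in> S - Z \<Longrightarrow>
                 f (proj_pt v) = proj_pt (\<lambda>i. if i \<le> m then F i v else 0)"
      by simp_all
    let ?D = "{v \<in> ?U. proj_pt v \<notin> Z}" and ?F = "\<lambda>v i. if i \<le> m then F i v else 0"
    have "?D = ?U \<inter> {v \<in> ?V. proj_pt v \<notin> Z}" by blast
    then have "openin (top_of_set ?U) ?D"
      using openin_subtopology_Int2[OF openin_zariski_complement[OF Z(1)], of ?U]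
      by (simp add: subtopology_subtopology inf.absorb2)
    moreover have "continuous_on UNIV (\<lambda>v. if i \<le> m then F i v else 0)" for i
      using F[of i] continuous_on_polynomials[of "F i"] by (cases "i \<le> m") (auto simp: forms_def)
    then have "continuous_on UNIV ?F"
      by (rule continuous_on_coordinatewise_then_product)
    moreover have "?F v \<in> ?W" if "v \<in> ?D" for v
    proof -
      have "?F v \<in> topspace (Euclidean_space (Suc m))" by (auto simp: topspace_Euclidean_space)
      moreover have "?F v \<noteq> (\<lambda>_. 0)" using nz[of v] that by (auto simp: fun_eq_iff)
      ultimately show ?thesis unfolding nonzero_vectors_def by blast
    qed
    ultimately show ?thesis
      using v0 Z(2) fv by (intro exI[of _ ?D] exI[of _ ?F]) blast
  qed
  have "f ` S \<subseteq> proj_space m"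
  proof
    fix y assume "y \<in> f ` S"
    then obtain v where "v \<in> ?U" "y = f (proj_pt v)" using S unfolding proj_space_def by blast
    with local show "y \<in> proj_space m" unfolding proj_space_def by blast
  qed
  moreover have "openin (top_of_set ?U) {v \<in> ?U. f (proj_pt v) \<in> Q}" if Q: "openin (proj_topology m) Q" for Q
  proof (subst openin_subopen, intro ballI)
    fix v0 assume v0: "v0 \<in> {v \<in> ?U. f (proj_pt v) \<in> Q}"
    then obtain D F where D: "openin (top_of_set ?U) D" "v0 \<in> D" and F: "continuous_on UNIV F"
      and fF: "\<And>v. v \<in> D \<Longrightarrow> F v \<in> ?W \<and> f (proj_pt v) = proj_pt (F v)"
      using local[of v0] by blast
    have "openin (top_of_set ?W) {w \<in> ?W. proj_pt w \<in> Q}"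
      using Q by (simp add: proj_topology_eq openin_quotient_topology)
    then obtain O' where O': "open O'" "{w \<in> ?W. proj_pt w \<in> Q} = ?W \<inter> O'"
      by (auto simp: openin_open)
    have op: "open (F -` O')" using F O'(1) by (simp add: open_vimage)
    have "D \<subseteq> ?U" using D(1) openin_imp_subset by blast
    have mem: "f (proj_pt v) \<in> Q \<longleftrightarrow> v \<in> F -` O'" if "v \<in> D" for v
      using fF[OF that] O'(2) by auto
    show "\<exists>E. openin (top_of_set ?U) E \<and> v0 \<in> E \<and> E \<subseteq> {v \<in> ?U. f (proj_pt v) \<in> Q}"
    proof (intro exI conjI)
      show "openin (top_of_set ?U) (D \<inter> F -` O')" using D(1) op by (rule openin_Int_open)
      show "v0 \<in> D \<inter> F -` O'" using D(2) v0 mem by blast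
      show "D \<inter> F -` O' \<subseteq> {v \<in> ?U. f (proj_pt v) \<in> Q}" using mem \<open>D \<subseteq> ?U\<close> by blast
    qed
  qed
  ultimately show "continuous_map (top_of_set ?U) (proj_topology m) (f \<circ> proj_pt)"
    by (auto simp: continuous_map_def)
qed

text \<open>The inverse of \<^const>\<open>affine_pt\<close> on its image. The choice of the representative does not
  matter, since quotients of homogeneous coordinates do not depend on it.\<close>

definition affine_coords :: "nat \<Rightarrow> proj_point \<Rightarrow> nat \<Rightarrow> real" where
  "affine_coords d L = (let v = (SOME v. v \<in> L) in (\<lambda>i. if i < d then v i / v d else 0))"

lemma affine_coords_proj_pt: "affine_coords d (proj_pt v) = (\<lambda>i. if i < d then v i / v d else 0)"
proof -
  have "(SOME w. w \<in> proj_pt v) \<in> proj_pt v" by (rule someI[of _ v]) (rule proj_pt_self)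
  then obtain c where "c \<noteq> 0" "(SOME w. w \<in> proj_pt v) = (\<lambda>i. c * v i)"
    unfolding proj_pt_def by auto
  then show ?thesis by (simp add: affine_coords_def Let_def fun_eq_iff)
qed

lemma affine_coords_affine_pt:
  "x \<in> topspace (Euclidean_space d) \<Longrightarrow> affine_coords d (affine_pt d x) = x"
  by (auto simp: affine_pt_def affine_coords_proj_pt fun_eq_iff topspace_Euclidean_space)

lemma affine_pt_vector:
  "x \<in> topspace (Euclidean_space d) \<Longrightarrow> x(d := 1) \<in> nonzero_vectors (Suc d)"
  by (auto simp: nonzero_vectors_def topspace_Euclidean_space fun_eq_iff)

lemma continuous_map_affine_pt:
  "continuous_map (top_of_set (topspace (Euclidean_space d))) (proj_topology d) (affine_pt d)"
proof -
  let ?E = "topspace (Euclidean_space d)"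
  have "continuous_on ?E (\<lambda>x. if i = d then 1 else x i)" for i
    by (cases "i = d") (simp_all add: continuous_on_subset[OF continuous_on_product_coordinates])
  then have "continuous_on ?E (\<lambda>x i. if i = d then 1 else x i)"
    by (rule continuous_on_coordinatewise_then_product)
  then have "continuous_on ?E (\<lambda>x. x(d := 1))" by (simp only: fun_upd_def)
  moreover have "(\<lambda>x. x(d := 1)) \<in> ?E \<rightarrow> nonzero_vectors (Suc d)"
    using affine_pt_vector by blast
  ultimately have "continuous_map (top_of_set ?E) (top_of_set (nonzero_vectors (Suc d))) (\<lambda>x. x(d := 1))"
    unfolding continuous_map_in_subtopology by (simp add: image_subset_iff_funcset)
  from continuous_map_compose[OF this continuous_map_proj_pt] show ?thesis
    by (simp add: affine_pt_def[abs_def] comp_def)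
qed

lemma continuous_map_affine_coords:
  "continuous_map (subtopology (proj_topology d) (affine_pt d ` topspace (Euclidean_space d)))
     euclidean (affine_coords d)"
proof (rule continuous_map_from_proj)
  show "affine_pt d ` topspace (Euclidean_space d) \<subseteq> proj_space d"
    using affine_pt_vector unfolding proj_space_def affine_pt_def by blast
  let ?U = "{v \<in> nonzero_vectors (Suc d). proj_pt v \<in> affine_pt d ` topspace (Euclidean_space d)}"
  have nz: "v d \<noteq> 0" if "v \<in> ?U" for v
  proof -
    from that obtain x where "proj_pt v = proj_pt (x(d := 1))" unfolding affine_pt_def by blast
    then obtain c where "c \<noteq> 0" "v = (\<lambda>i. c * (x(d := 1)) i)" by (rule proj_pt_eqE)
    then show ?thesis by simp
  qed
  have coord: "continuous_on ?U (\<lambda>v. v i)" for i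
    by (rule continuous_on_subset[OF continuous_on_product_coordinates]) auto
  have "continuous_on ?U (\<lambda>v. if i < d then v i / v d else 0)" for i
    using continuous_on_divide[OF coord[of i] coord[of d]] nz by (cases "i < d") simp_all
  then have "continuous_on ?U (\<lambda>v i. if i < d then v i / v d else 0)"
    by (rule continuous_on_coordinatewise_then_product)
  then show "continuous_map (top_of_set ?U) euclidean (affine_coords d \<circ> proj_pt)"
    by (simp add: affine_coords_proj_pt comp_def)
qed

text \<open>Followed by the embedding of affine space, a realization is regular with regular inverse, hence
  a homeomorphism between the Zariski closures; the embedding and its inverse are continuous.\<close>

lemma affine_realization_homeomorphic_map:
  assumes "G_AS_set G n \<alpha> X" and "affine_realization G n \<alpha> X d \<tau> \<Phi>"
  shows "homeomorphic_map (subtopology (proj_topology n) X) (top_of_set (\<Phi> ` X)) \<Phi>"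
proof -
  let ?X = "zariski_closure n X" and ?Y = "affine_zariski_closure d (\<Phi> ` X)"
  let ?E = "topspace (Euclidean_space d)" and ?h = "affine_pt d \<circ> \<Phi>"
  have X: "X \<subseteq> proj_space n" using assms(1) AS_sets_subset by (auto simp: G_AS_set_def)
  note Xb = subset_zariski_closure[of X n] zariski_closure_subset[OF X]
  have bi: "biregular_map n ?X d (affine_pt d ` ?Y) ?h" and im: "\<Phi> ` ?X = ?Y" "\<Phi> ` X \<subseteq> ?E"
    using assms(2) by (auto simp: affine_realization_def)
  have "?Y \<subseteq> ?E"
    unfolding affine_zariski_closure_def using im(2) by (intro Inter_lower) auto
  then have img: "affine_pt d ` ?Y \<subseteq> affine_pt d ` ?E" "affine_pt d ` ?Y \<subseteq> proj_space d"
    using affine_pt_vector unfolding proj_space_def affine_pt_def by blast+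
  have inj: "inj_on ?h ?X" using bi by (simp add: biregular_map_def bij_betw_def)
  have reg: "regular_map n ?X d (affine_pt d ` ?Y) ?h"
    "regular_map d (affine_pt d ` ?Y) n ?X (inv_into ?X ?h)"
    using bi by (auto simp: biregular_map_def)
  have "continuous_map (subtopology (proj_topology n) ?X)
      (subtopology (proj_topology d) (affine_pt d ` ?E)) ?h"
    using continuous_map_regular_map[OF reg(1) Xb(2)] conjunct1[OF reg(1)[unfolded regular_map_def]] img(1)
    unfolding continuous_map_in_subtopology image_subset_iff_funcset[symmetric] by (metis inf.coboundedI2 order_trans image_mono topspace_subtopology inf_le2)
  from continuous_map_compose[OF this continuous_map_affine_coords]
  have "continuous_map (subtopology (proj_topology n) ?X) euclidean \<Phi>"
    by (rule continuous_map_eq) (use im(1) \<open>?Y \<subseteq> ?E\<close> affine_coords_affine_pt in auto)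
  then have cont: "continuous_map (subtopology (proj_topology n) X) (top_of_set (\<Phi> ` X)) \<Phi>"
    using Xb(1) by (auto simp: continuous_map_in_subtopology intro: continuous_map_from_subtopology_mono)
  let ?\<Psi> = "inv_into ?X ?h \<circ> affine_pt d"
  have inv: "?\<Psi> (\<Phi> x) = x" if "x \<in> X" for x
    using inv_into_f_f[OF inj, of x] Xb(1) that by auto
  have "continuous_map (top_of_set ?Y) (subtopology (proj_topology d) (affine_pt d ` ?Y)) (affine_pt d)"
    using continuous_map_from_subtopology_mono[OF continuous_map_affine_pt \<open>?Y \<subseteq> ?E\<close>]
    by (auto simp: continuous_map_in_subtopology)
  from continuous_map_compose[OF this continuous_map_regular_map[OF reg(2) img(2)]]
  have "continuous_map (top_of_set ?Y) (proj_topology n) ?\<Psi>" .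
  then have "continuous_map (top_of_set (\<Phi> ` X)) (proj_topology n) ?\<Psi>"
    using im(1) Xb(1) by (auto intro: continuous_map_from_subtopology_mono)
  moreover have "?\<Psi> ` \<Phi> ` X \<subseteq> X" using inv by auto
  ultimately have "continuous_map (top_of_set (\<Phi> ` X)) (subtopology (proj_topology n) X) ?\<Psi>"
    by (auto simp: continuous_map_in_subtopology)
  with cont inv have "homeomorphic_maps (subtopology (proj_topology n) X) (top_of_set (\<Phi> ` X)) \<Phi> ?\<Psi>"
    by (auto simp: homeomorphic_maps_def)
  then show ?thesis by (rule homeomorphic_maps_imp_map)
qed

section \<open>Stiefel manifolds\<close>

lemma matrices_mono: "k \<le> l \<Longrightarrow> matrices k N \<subseteq> matrices l N"
  by (auto simp: matrices_def)

lemma stiefel_mono: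
  assumes "k \<le> l"
  shows "stiefel N k \<subseteq> stiefel N l"
proof
  fix A assume A: "A \<in> stiefel N k"
  then have 0: "A (i, j) = 0" if "k \<le> i" for i j
    using that by (auto simp: stiefel_def matrices_def)
  have "(\<Sum>i<l. A (i, a) * A (i, b)) = (\<Sum>i<k. A (i, a) * A (i, b))" for a b
    by (rule sum.mono_neutral_right) (use assms 0 in auto)
  then show "A \<in> stiefel N l"
    using A matrices_mono[OF assms] by (auto simp: stiefel_def)
qed

lemma continuous_on_entry: "continuous_on S (\<lambda>A. A ij)" for ij :: "nat \<times> nat" and S :: "real_matrix set"
  by (rule continuous_on_subset[OF continuous_on_product_coordinates]) auto

lemma closed_stiefel: "closed (stiefel N k)"
proof -
  have "stiefel N k = (\<Inter>ij\<in>{(i, j). k \<le> i \<or> N \<le> j}. {A. A ij = 0}) \<inter>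
      (\<Inter>jl\<in>{..<N} \<times> {..<N}. {A. (\<Sum>i<k. A (i, fst jl) * A (i, snd jl)) = (if fst jl = snd jl then 1 else 0)})"
    by (auto simp: stiefel_def matrices_def)
  also have "closed \<dots>"
    by (intro closed_Int closed_INT ballI closed_Collect_eq continuous_on_sum continuous_on_mult
        continuous_on_entry continuous_on_const)
  finally show ?thesis .
qed

lemma openin_stiefel_infinity:
  "openin (stiefel_infinity N) U \<longleftrightarrow>
     U \<subseteq> (\<Union>k. stiefel N k) \<and> (\<forall>k. openin (top_of_set (stiefel N k)) (U \<inter> stiefel N k))"
  by (simp add: stiefel_infinity_def openin_colimit_topology euclidean_product_topology)

lemma topspace_stiefel_infinity [simp]: "topspace (stiefel_infinity N) = (\<Union>k. stiefel N k)"
proof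
  show "topspace (stiefel_infinity N) \<subseteq> (\<Union>k. stiefel N k)"
    using openin_topspace openin_stiefel_infinity by metis
  have "(\<Union>k. stiefel N k) \<inter> stiefel N m = stiefel N m" for m by blast
  then have "openin (stiefel_infinity N) (\<Union>k. stiefel N k)"
    by (simp add: openin_stiefel_infinity)
  then show "(\<Union>k. stiefel N k) \<subseteq> topspace (stiefel_infinity N)" by (rule openin_subset)
qed

lemma closedin_stiefel_infinity:
  "closedin (stiefel_infinity N) C \<longleftrightarrow> C \<subseteq> (\<Union>k. stiefel N k) \<and> (\<forall>k. closed (C \<inter> stiefel N k))"
proof -
  have "((\<Union>k. stiefel N k) - C) \<inter> stiefel N m = stiefel N m - C \<inter> stiefel N m" for m by blast
  then have "openin (top_of_set (stiefel N m)) (((\<Union>k. stiefel N k) - C) \<inter> stiefel N m) \<longleftrightarrow>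
      closed (C \<inter> stiefel N m)" for m
    using closedin_closed_eq[OF closed_stiefel, of N m "C \<inter> stiefel N m"] by (simp add: closedin_def)
  then show ?thesis
    unfolding closedin_def[of "stiefel_infinity N"] by (auto simp: openin_stiefel_infinity)
qed

lemma closedin_stiefel: "closedin (stiefel_infinity N) (stiefel N k)"
  unfolding closedin_stiefel_infinity using closed_stiefel by blast

text \<open>Each stage is closed in the space of all real matrices, so a subset of it that is closed in it
  has closed trace on every other stage.\<close>

lemma subtopology_stiefel_infinity:
  "subtopology (stiefel_infinity N) (stiefel N k) = top_of_set (stiefel N k)"
proof -
  have "closedin (subtopology (stiefel_infinity N) (stiefel N k)) C \<longleftrightarrow>
      closedin (top_of_set (stiefel N k)) C" for C
  proof -
    have "closedin (subtopology (stiefel_infinity N) (stiefel N k)) C \<longleftrightarrow>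
        closedin (stiefel_infinity N) C \<and> C \<subseteq> stiefel N k"
      by (rule closedin_closed_subtopology[OF closedin_stiefel])
    also have "\<dots> \<longleftrightarrow> closed C \<and> C \<subseteq> stiefel N k"
      unfolding closedin_stiefel_infinity
    proof safe
      assume "\<forall>k. closed (C \<inter> stiefel N k)" "C \<subseteq> stiefel N k"
      then show "closed C" by (metis inf.absorb1)
    qed (use closed_stiefel in auto)
    also have "\<dots> \<longleftrightarrow> closedin (top_of_set (stiefel N k)) C"
      by (simp add: closedin_closed_eq[OF closed_stiefel])
    finally show ?thesis .
  qed
  moreover have "topspace (subtopology (stiefel_infinity N) (stiefel N k)) = stiefel N k" by auto
  ultimately show ?thesis
    unfolding topology_eq openin_closedin_eq by simp
qed

section \<open>Orbits of finite permutation groups and invariant polynomials\<close>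

lemma generated_algebra_sum:
  "(\<And>s. s \<in> I \<Longrightarrow> g s \<in> generated_algebra S) \<Longrightarrow> (\<lambda>z. \<Sum>s\<in>I. g s z) \<in> generated_algebra S"
  by (induction I rule: infinite_finite_induct) (auto intro: generated_algebra.intros)

lemma generated_algebra_prod:
  "(\<And>s. s \<in> I \<Longrightarrow> g s \<in> generated_algebra S) \<Longrightarrow> (\<lambda>z. \<Prod>s\<in>I. g s z) \<in> generated_algebra S"
  by (induction I rule: infinite_finite_induct) (auto intro: generated_algebra.intros)

lemma generated_algebra_square_diff:
  assumes "f \<in> generated_algebra S"
  shows "(\<lambda>z. (f z - c)\<^sup>2) \<in> generated_algebra S"
proof -
  have "(\<lambda>z. (f z + - c) * (f z + - c)) \<in> generated_algebra S"
    using assms generated_algebra.const[of "- c" S] by (intro generated_algebra.mult generated_algebra.add)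
  then show ?thesis by (simp add: power2_eq_square)
qed

text \<open>On the vectors that agree with \<open>w\<close> outside of a finite set of indices, the product topology is
  the Euclidean one: the least of finitely many radii serves for all coordinates.\<close>

lemma open_contains_sum_squares_ball:
  fixes Q :: "('i \<Rightarrow> real) set"
  assumes "finite I" "open Q" "w \<in> Q"
  shows "\<exists>\<epsilon>>0. \<forall>v. (\<forall>i. i \<notin> I \<longrightarrow> v i = w i) \<and> (\<Sum>i\<in>I. (v i - w i)\<^sup>2) < \<epsilon> \<longrightarrow> v \<in> Q"
proof -
  have "openin (product_topology (\<lambda>i. euclidean) UNIV) Q"
    using assms(2) by (simp add: euclidean_product_topology)
  from product_topology_open_contains_basis[OF this assms(3)] obtain U where
    U: "w \<in> (\<Pi>\<^sub>E i\<in>UNIV. U i)" "\<And>i. open (U i)" "(\<Pi>\<^sub>E i\<in>UNIV. U i) \<subseteq> Q"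
    by auto
  have "\<exists>e>0. \<forall>x. \<bar>x - w i\<bar> < e \<longrightarrow> x \<in> U i" for i
    using U(1,2) open_real_def by (metis PiE_iff UNIV_I dist_real_def open_dist)
  then obtain e where e: "\<And>i. e i > 0" "\<And>i x. \<bar>x - w i\<bar> < e i \<Longrightarrow> x \<in> U i" by metis
  define \<epsilon> where "\<epsilon> = Min (insert 1 ((\<lambda>i. (e i)\<^sup>2) ` I))"
  have "\<epsilon> > 0" unfolding \<epsilon>_def using assms(1) by (subst Min_gr_iff) (auto simp: less_imp_neq[OF e(1), THEN not_sym])
  moreover have "v \<in> Q" if v: "\<forall>i. i \<notin> I \<longrightarrow> v i = w i" "(\<Sum>i\<in>I. (v i - w i)\<^sup>2) < \<epsilon>" for v
  proof -
    have "v i \<in> U i" for i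
    proof (cases "i \<in> I")
      case True
      then have "(v i - w i)\<^sup>2 \<le> (\<Sum>i\<in>I. (v i - w i)\<^sup>2)"
        using assms(1) by (intro member_le_sum) auto
      also note v(2)
      also have "\<epsilon> \<le> (e i)\<^sup>2" unfolding \<epsilon>_def using assms(1) True by (intro Min_le) auto
      finally have "\<not> \<bar>e i\<bar> \<le> \<bar>v i - w i\<bar>" by (simp add: abs_le_square_iff)
      then have "\<bar>v i - w i\<bar> < e i" using e(1)[of i] by simp
      then show ?thesis by (rule e(2))
    next
      case False
      then show ?thesis using v(1) e(1)[of i] by (intro e(2)) simp
    qed
    then show ?thesis using U(3) by auto
  qed
  ultimately show ?thesis by blast
qed

locale permutation_actions = group G for G :: "('g, 'b) monoid_scheme" (structure) +
  fixes d N :: nat and \<tau> \<rho> :: "'g \<Rightarrow> nat \<Rightarrow> nat"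
  assumes finite_G: "finite (carrier G)"
    and \<tau>: "group_action G {..<d} \<tau>" and \<rho>: "group_action G {..<N} \<rho>"
begin

abbreviation action :: "'g \<Rightarrow> (nat \<Rightarrow> real) \<times> real_matrix \<Rightarrow> (nat \<Rightarrow> real) \<times> real_matrix" where
  "action \<equiv> borel_action G N \<rho> (coordinate_action G d \<tau>)"

lemma permutation_less:
  "g \<in> carrier G \<Longrightarrow> i < d \<Longrightarrow> \<tau> g i < d" "g \<in> carrier G \<Longrightarrow> j < N \<Longrightarrow> \<rho> g j < N"
  using group_action.element_image[OF \<tau>] group_action.element_image[OF \<rho>] by blast+

lemma coordinate_action_mult:
  assumes "g \<in> carrier G" "h \<in> carrier G"
  shows "coordinate_action G d \<tau> g (coordinate_action G d \<tau> h x) = coordinate_action G d \<tau> (g \<otimes> h) x"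
  using assms permutation_less
  by (auto simp: coordinate_action_def fun_eq_iff inv_mult_group group_action.composition_rule[OF \<tau>])

lemma matrix_action_mult:
  assumes "g \<in> carrier G" "h \<in> carrier G"
  shows "matrix_action G N \<rho> g (matrix_action G N \<rho> h A) = matrix_action G N \<rho> (g \<otimes> h) A"
  using assms permutation_less
  by (auto simp: matrix_action_def fun_eq_iff inv_mult_group group_action.composition_rule[OF \<rho>])

lemma coordinate_action_one: "x \<in> topspace (Euclidean_space d) \<Longrightarrow> coordinate_action G d \<tau> \<one> x = x"
  using group_action.id_eq_one[OF \<tau>, symmetric]
  by (auto simp: coordinate_action_def fun_eq_iff topspace_Euclidean_space)

lemma matrix_action_one: "A \<in> matrices k N \<Longrightarrow> matrix_action G N \<rho> \<one> A = A"
  using group_action.id_eq_one[OF \<rho>, symmetric]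
  by (auto simp: matrix_action_def fun_eq_iff matrices_def)

lemma coordinate_action_closed: "coordinate_action G d \<tau> g x \<in> topspace (Euclidean_space d)"
  by (simp add: coordinate_action_def topspace_Euclidean_space)

lemma matrix_action_closed: "A \<in> matrices k N \<Longrightarrow> matrix_action G N \<rho> g A \<in> matrices k N"
  by (auto simp: matrix_action_def matrices_def)

lemma matrix_action_stiefel:
  assumes g: "g \<in> carrier G" and A: "A \<in> stiefel N k"
  shows "matrix_action G N \<rho> g A \<in> stiefel N k"
proof -
  have inj: "\<rho> (inv g) j = \<rho> (inv g) l \<longleftrightarrow> j = l" if "j < N" "l < N" for j l
    using group_action.inj_prop[OF \<rho>, of "inv g"] g that by (auto simp: inj_on_def)
  show ?thesis
    using A matrix_action_closed[of A k g] permutation_less(2)[of "inv g"] g inj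
    by (simp add: stiefel_def) (simp add: matrix_action_def)
qed

lemma action_mult:
  "g \<in> carrier G \<Longrightarrow> h \<in> carrier G \<Longrightarrow> action g (action h z) = action (g \<otimes> h) z"
  by (cases z) (simp add: borel_action_def coordinate_action_mult matrix_action_mult)

lemma action_one: "z \<in> topspace (Euclidean_space d) \<times> matrices k N \<Longrightarrow> action \<one> z = z"
  by (cases z) (simp add: borel_action_def coordinate_action_one matrix_action_one[where k = k])

lemma action_closed:
  "z \<in> topspace (Euclidean_space d) \<times> matrices k N \<Longrightarrow> action g z \<in> topspace (Euclidean_space d) \<times> matrices k N"
  by (cases z) (simp add: borel_action_def coordinate_action_closed matrix_action_closed)

text \<open>The square of the Euclidean distance on pairs of a vector in \<open>\<real>\<^sup>d\<close> and a \<open>k \<times> N\<close> matrix; on the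
  surrounding space of sequences and infinite matrices it does not separate points. It is squared in
  order to be a polynomial.\<close>

definition sq_dist :: "nat \<Rightarrow> (nat \<Rightarrow> real) \<times> real_matrix \<Rightarrow> (nat \<Rightarrow> real) \<times> real_matrix \<Rightarrow> real" where
  "sq_dist k z w = (\<Sum>i<d. (fst z i - fst w i)\<^sup>2) + (\<Sum>ij\<in>{..<k} \<times> {..<N}. (snd z ij - snd w ij)\<^sup>2)"

lemma sq_dist_self [simp]: "sq_dist k w w = 0"
  by (simp add: sq_dist_def)

lemma sq_dist_open:
  assumes Q: "open Q1" "open Q2" and w: "w \<in> Q1 \<times> Q2"
    and wk: "w \<in> topspace (Euclidean_space d) \<times> matrices k N"
  shows "\<exists>\<epsilon>>0. \<forall>z\<in>topspace (Euclidean_space d) \<times> matrices k N. sq_dist k z w < \<epsilon> \<longrightarrow> z \<in> Q1 \<times> Q2"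
proof -
  from w have w': "fst w \<in> Q1" "snd w \<in> Q2" by auto
  obtain e1 where e1: "e1 > 0" "\<And>v. (\<forall>i. i \<notin> {..<d} \<longrightarrow> v i = fst w i) \<and>
      (\<Sum>i<d. (v i - fst w i)\<^sup>2) < e1 \<Longrightarrow> v \<in> Q1"
    using open_contains_sum_squares_ball[OF finite_lessThan Q(1) w'(1), of d] by blast
  obtain e2 where e2: "e2 > 0" "\<And>v. (\<forall>i. i \<notin> {..<k} \<times> {..<N} \<longrightarrow> v i = snd w i) \<and>
      (\<Sum>i\<in>{..<k} \<times> {..<N}. (v i - snd w i)\<^sup>2) < e2 \<Longrightarrow> v \<in> Q2"
    using open_contains_sum_squares_ball[OF _ Q(2) w'(2), of "{..<k} \<times> {..<N}"] by auto
  have "z \<in> Q1 \<times> Q2" if z: "z \<in> topspace (Euclidean_space d) \<times> matrices k N"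
    and small: "sq_dist k z w < min e1 e2" for z
  proof -
    have "(\<Sum>i<d. (fst z i - fst w i)\<^sup>2) \<ge> 0" "(\<Sum>ij\<in>{..<k} \<times> {..<N}. (snd z ij - snd w ij)\<^sup>2) \<ge> 0"
      by (simp_all add: sum_nonneg)
    then have "(\<Sum>i<d. (fst z i - fst w i)\<^sup>2) < e1" "(\<Sum>ij\<in>{..<k} \<times> {..<N}. (snd z ij - snd w ij)\<^sup>2) < e2"
      using small unfolding sq_dist_def by linarith+
    moreover have "\<forall>i. i \<notin> {..<d} \<longrightarrow> fst z i = fst w i"
      using z wk by (auto simp: topspace_Euclidean_space mem_Times_iff)
    moreover have "\<forall>i. i \<notin> {..<k} \<times> {..<N} \<longrightarrow> snd z i = snd w i"
      using z wk by (auto simp: matrices_def mem_Times_iff)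
    ultimately show ?thesis using e1(2)[of "fst z"] e2(2)[of "snd z"] by (simp add: mem_Times_iff)
  qed
  then show ?thesis using e1(1) e2(1) by (intro exI[of _ "min e1 e2"]) auto
qed

lemma sq_dist_eq_0:
  assumes "z \<in> topspace (Euclidean_space d) \<times> matrices k N" "w \<in> topspace (Euclidean_space d) \<times> matrices k N"
    and "sq_dist k z w = 0"
  shows "z = w"
proof -
  have "(\<Sum>i<d. (fst z i - fst w i)\<^sup>2) \<ge> 0" "(\<Sum>ij\<in>{..<k} \<times> {..<N}. (snd z ij - snd w ij)\<^sup>2) \<ge> 0"
    by (simp_all add: sum_nonneg)
  with assms(3) have "(\<Sum>i<d. (fst z i - fst w i)\<^sup>2) = 0" "(\<Sum>ij\<in>{..<k} \<times> {..<N}. (snd z ij - snd w ij)\<^sup>2) = 0"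
    unfolding sq_dist_def by linarith+
  then have *: "\<And>i. i < d \<Longrightarrow> fst z i = fst w i" "\<And>ij. ij \<in> {..<k} \<times> {..<N} \<Longrightarrow> snd z ij = snd w ij"
    by (auto simp: sum_nonneg_eq_0_iff)
  have "fst z i = fst w i" for i
    using *(1) assms(1,2) by (cases "i < d") (auto simp: topspace_Euclidean_space mem_Times_iff)
  moreover have "snd z ij = snd w ij" for ij
  proof (cases "ij \<in> {..<k} \<times> {..<N}")
    case False
    then show ?thesis using assms(1,2) by (cases ij) (auto simp: matrices_def mem_Times_iff not_less)
  qed (rule *(2))
  ultimately show ?thesis by (simp add: prod_eq_iff fun_eq_iff)
qed

text \<open>A polynomial in \<open>z\<close> that measures the distance to the orbit of \<open>w\<close>. Taking the product over the
  group makes it invariant while keeping it small only near this orbit.\<close>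

definition orbit_polynomial :: "nat \<Rightarrow> (nat \<Rightarrow> real) \<times> real_matrix \<Rightarrow> (nat \<Rightarrow> real) \<times> real_matrix \<Rightarrow> real" where
  "orbit_polynomial k w z = (\<Prod>g\<in>carrier G. sq_dist k (action g z) w)"

lemma orbit_polynomial_invariant: "orbit_polynomial k w \<in> invariant_polynomials G d \<tau> N \<rho> k"
  unfolding invariant_polynomials_def
proof (intro CollectI conjI ballI)
  let ?S = "{\<lambda>z. fst z i | i. i < d} \<union> {\<lambda>z. snd z (i, j) | i j. i < k \<and> j < N} ::
    ((nat \<Rightarrow> real) \<times> real_matrix \<Rightarrow> real) set"
  have "(\<lambda>z. sq_dist k (action g z) w) \<in> generated_algebra ?S" if g: "g \<in> carrier G" for g
  proof -
    have "sq_dist k (action g z) w = (\<Sum>i<d. (fst z (\<tau> (inv g) i) - fst w i)\<^sup>2) +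
        (\<Sum>ij\<in>{..<k} \<times> {..<N}. (snd z (fst ij, \<rho> (inv g) (snd ij)) - snd w ij)\<^sup>2)" for z
      unfolding sq_dist_def
      by (intro arg_cong2[where f = "(+)"] sum.cong)
        (auto simp: borel_action_def coordinate_action_def matrix_action_def)
    moreover have "(\<lambda>z. (\<Sum>i<d. (fst z (\<tau> (inv g) i) - fst w i)\<^sup>2) +
        (\<Sum>ij\<in>{..<k} \<times> {..<N}. (snd z (fst ij, \<rho> (inv g) (snd ij)) - snd w ij)\<^sup>2)) \<in> generated_algebra ?S"
    proof (intro generated_algebra.add generated_algebra_sum generated_algebra_square_diff
        generated_algebra.gen)
      show "(\<lambda>z. fst z (\<tau> (inv g) i)) \<in> ?S" if "i \<in> {..<d}" for i
        using permutation_less(1)[of "inv g" i] g that by blast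
      show "(\<lambda>z. snd z (fst ij, \<rho> (inv g) (snd ij))) \<in> ?S" if "ij \<in> {..<k} \<times> {..<N}" for ij
        using permutation_less(2)[of "inv g" "snd ij"] g that
        by (intro UnI2 CollectI exI[of _ "fst ij"] exI[of _ "\<rho> (inv g) (snd ij)"]) auto
    qed
    ultimately show ?thesis by simp
  qed
  then show "orbit_polynomial k w \<in> product_polynomials d k N"
    unfolding orbit_polynomial_def[abs_def] product_polynomials_def by (rule generated_algebra_prod)
  fix h z assume h: "h \<in> carrier G"
  have "orbit_polynomial k w (action h z) = (\<Prod>g\<in>carrier G. sq_dist k (action (g \<otimes> h) z) w)"
    unfolding orbit_polynomial_def by (rule prod.cong) (auto simp: action_mult h)
  also have "\<dots> = orbit_polynomial k w z"
    unfolding orbit_polynomial_def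
    by (rule prod.reindex_bij_witness[where i = "\<lambda>g. g \<otimes> inv h" and j = "\<lambda>g. g \<otimes> h"])
      (auto simp: h m_assoc)
  finally show "orbit_polynomial k w (action h z) = orbit_polynomial k w z" .
qed

lemma orbit_polynomial_self:
  assumes "w \<in> topspace (Euclidean_space d) \<times> matrices k N"
  shows "orbit_polynomial k w w = 0"
  unfolding orbit_polynomial_def
  by (rule prod_zero[OF finite_G]) (use action_one[OF assms] in force)

lemma orbit_polynomial_small:
  assumes "orbit_polynomial k w z < \<epsilon> ^ card (carrier G)" and "\<epsilon> > 0"
  shows "\<exists>g\<in>carrier G. sq_dist k (action g z) w < \<epsilon>"
proof (rule ccontr)
  assume "\<not> ?thesis"
  then have "(\<Prod>g\<in>carrier G. \<epsilon>) \<le> orbit_polynomial k w z"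
    unfolding orbit_polynomial_def by (intro prod_mono) (use assms(2) in force)
  then show False using assms(1) by simp
qed

text \<open>An element of the algebra generated by \<open>P k\<close> is a polynomial in these generators; of this
  polynomial \<open>F\<close> only the continuity is recorded.\<close>

lemma generated_algebra_factors:
  assumes "f \<in> generated_algebra (set (P k))"
  shows "\<exists>F. continuous_on UNIV F \<and> (\<forall>z. f z = F (quotient_map_pi P k z))"
  using assms
proof induction
  case (const c)
  then show ?case by (intro exI[of _ "\<lambda>_. c"]) auto
next
  case (gen f)
  then obtain i where "i < length (P k)" "f = P k ! i" by (auto simp: in_set_conv_nth)
  then show ?case by (intro exI[of _ "\<lambda>w. w i"]) (auto simp: quotient_map_pi_def)
next
  case (add f g)
  then obtain F H where "continuous_on UNIV F" "\<forall>z. f z = F (quotient_map_pi P k z)"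
    "continuous_on UNIV H" "\<forall>z. g z = H (quotient_map_pi P k z)" by blast
  then show ?case by (intro exI[of _ "\<lambda>w. F w + H w"]) (auto intro: continuous_on_add)
next
  case (mult f g)
  then obtain F H where "continuous_on UNIV F" "\<forall>z. f z = F (quotient_map_pi P k z)"
    "continuous_on UNIV H" "\<forall>z. g z = H (quotient_map_pi P k z)" by blast
  then show ?case by (intro exI[of _ "\<lambda>w. F w * H w"]) (auto intro: continuous_on_mult)
qed

lemma quotient_map_pi_action:
  assumes P: "invariant_generators G d \<tau> N \<rho> P" and "g \<in> carrier G"
    and "z \<in> topspace (Euclidean_space d) \<times> matrices k N"
  shows "quotient_map_pi P k (action g z) = quotient_map_pi P k z"
proof -
  have "f (action g z) = f z" if "f \<in> set (P k)" for f
  proof -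
    have "f \<in> invariant_polynomials G d \<tau> N \<rho> k"
      using P generated_algebra.gen[OF that] by (auto simp: invariant_generators_def)
    then show ?thesis using assms(2,3) unfolding invariant_polynomials_def by blast
  qed
  then show ?thesis by (auto simp: quotient_map_pi_def fun_eq_iff)
qed

text \<open>The topology of the orbit space is that of its image under \<open>\<pi>\<^sub>k\<close>: points with nearby images
  have nearby orbits. The neighbourhood \<open>W\<close> is cut out by the orbit polynomial of \<open>w\<close>, written in terms
  of the generators.\<close>

lemma quotient_map_pi_near:
  assumes P: "invariant_generators G d \<tau> N \<rho> P" and w: "w \<in> topspace (Euclidean_space d) \<times> matrices k N"
    and "\<epsilon> > 0"
  shows "\<exists>W. open W \<and> quotient_map_pi P k w \<in> W \<and>
    (\<forall>z. quotient_map_pi P k z \<in> W \<longrightarrow> (\<exists>g\<in>carrier G. sq_dist k (action g z) w < \<epsilon>))"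
proof -
  have "orbit_polynomial k w \<in> generated_algebra (set (P k))"
    using P orbit_polynomial_invariant by (simp add: invariant_generators_def)
  then obtain F where F: "continuous_on UNIV F" "\<And>z. orbit_polynomial k w z = F (quotient_map_pi P k z)"
    using generated_algebra_factors by blast
  show ?thesis
  proof (intro exI conjI allI impI)
    show "open {x. F x < \<epsilon> ^ card (carrier G)}"
      using F(1) by (intro open_Collect_less continuous_on_const)
    show "quotient_map_pi P k w \<in> {x. F x < \<epsilon> ^ card (carrier G)}"
      using F(2)[of w] orbit_polynomial_self[OF w] assms(3) by simp
    fix z assume "quotient_map_pi P k z \<in> {x. F x < \<epsilon> ^ card (carrier G)}"
    then show "\<exists>g\<in>carrier G. sq_dist k (action g z) w < \<epsilon>"
      using F(2)[of z] by (intro orbit_polynomial_small[OF _ assms(3)]) simp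
  qed
qed

text \<open>Points with the same values of all invariants give the same value of the orbit polynomial of
  \<open>w\<close>, which vanishes only on the orbit of \<open>w\<close>.\<close>

lemma quotient_map_pi_eqD:
  assumes P: "invariant_generators G d \<tau> N \<rho> P"
    and z: "z \<in> topspace (Euclidean_space d) \<times> matrices k N" and w: "w \<in> topspace (Euclidean_space d) \<times> matrices k N"
    and eq: "quotient_map_pi P k z = quotient_map_pi P k w"
  shows "\<exists>g\<in>carrier G. action g z = w"
proof -
  have "orbit_polynomial k w \<in> generated_algebra (set (P k))"
    using P orbit_polynomial_invariant by (simp add: invariant_generators_def)
  then have "orbit_polynomial k w z = orbit_polynomial k w w"
    using generated_algebra_factors[of "orbit_polynomial k w" P k] eq by metis
  then have "orbit_polynomial k w z = 0" using orbit_polynomial_self[OF w] by simp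
  then obtain g where "g \<in> carrier G" "sq_dist k (action g z) w = 0"
    unfolding orbit_polynomial_def using finite_G by auto
  then show ?thesis using sq_dist_eq_0[OF action_closed[OF z] w] by blast
qed

lemma continuous_on_quotient_map_pi:
  assumes P: "invariant_generators G d \<tau> N \<rho> P"
  shows "continuous_on UNIV (quotient_map_pi P k)"
proof -
  have "continuous_on UNIV f" if f: "f \<in> set (P k)" for f
  proof -
    have "f \<in> product_polynomials d k N"
      using P generated_algebra.gen[OF f] by (auto simp: invariant_generators_def invariant_polynomials_def)
    moreover have "continuous_on UNIV (\<lambda>z :: (nat \<Rightarrow> real) \<times> real_matrix. fst z i)"
      "continuous_on UNIV (\<lambda>z :: (nat \<Rightarrow> real) \<times> real_matrix. snd z ij)" for i ij
      by (rule continuous_on_product_then_coordinatewise, intro continuous_on_fst continuous_on_snd continuous_on_id)+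
    ultimately show ?thesis
      unfolding product_polynomials_def by (elim continuous_on_generated_algebra) blast
  qed
  then have "continuous_on UNIV (\<lambda>z. if i < length (P k) then (P k ! i) z else 0)" for i
    by (cases "i < length (P k)") simp_all
  then show ?thesis
    unfolding quotient_map_pi_def[abs_def] by (rule continuous_on_coordinatewise_then_product)
qed

end

section \<open>The Borel construction\<close>

locale borel_approximation = permutation_actions G d N \<tau> \<rho>
  for G :: "('g, 'b) monoid_scheme" (structure) and d N :: nat and \<tau> \<rho> :: "'g \<Rightarrow> nat \<Rightarrow> nat" +
  fixes n :: nat and X :: "proj_point set" and \<alpha> :: "'g \<Rightarrow> proj_point \<Rightarrow> proj_point"
    and \<Phi> :: "proj_point \<Rightarrow> nat \<Rightarrow> real"
    and P :: "nat \<Rightarrow> ((nat \<Rightarrow> real) \<times> real_matrix \<Rightarrow> real) list"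
  assumes X: "G_AS_set G n \<alpha> X" and \<Phi>: "affine_realization G n \<alpha> X d \<tau> \<Phi>"
    and P: "invariant_generators G d \<tau> N \<rho> P"
begin

abbreviation "X_top \<equiv> subtopology (proj_topology n) X"
abbreviation "total_space \<equiv> prod_topology X_top (stiefel_infinity N)"
abbreviation "V \<equiv> stiefel N"
abbreviation "act \<equiv> borel_action G N \<rho> \<alpha>"
abbreviation "orbit_of \<equiv> orbit G act"
abbreviation "B \<equiv> borel_space G N \<rho> n \<alpha> X"
abbreviation "S \<equiv> approx_space N P (\<Phi> ` X)"
abbreviation "j \<equiv> approx_to_borel G N \<rho> \<alpha> X \<Phi> P"
abbreviation "real_pt z \<equiv> (\<Phi> (fst z), snd z)"

definition pi_map :: "nat \<Rightarrow> proj_point \<times> real_matrix \<Rightarrow> nat \<Rightarrow> real" where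
  "pi_map k z = quotient_map_pi P k (real_pt z)"

lemma X_subset: "X \<subseteq> proj_space n"
  using X AS_sets_subset by (auto simp: G_AS_set_def)

lemma topspace_X_top [simp]: "topspace X_top = X"
  using X_subset by (simp add: inf.absorb2)

lemma closedin_X_top: "closedin X_top X"
  using closedin_topspace[of X_top] by (simp only: topspace_X_top)

lemma topspace_total_space: "topspace total_space = X \<times> (\<Union>k. V k)"
  by (simp only: topspace_prod_topology topspace_X_top topspace_stiefel_infinity)

lemma \<Phi>_range: "x \<in> X \<Longrightarrow> \<Phi> x \<in> topspace (Euclidean_space d)"
  using \<Phi> by (auto simp: affine_realization_def)

lemma \<Phi>_homeo: "homeomorphic_map X_top (top_of_set (\<Phi> ` X)) \<Phi>"
  by (rule affine_realization_homeomorphic_map[OF X \<Phi>])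

lemma \<Phi>_inj: "inj_on \<Phi> X"
  using homeomorphic_imp_injective_map[OF \<Phi>_homeo] by (simp only: topspace_X_top)

lemma \<alpha>_closed: "g \<in> carrier G \<Longrightarrow> x \<in> X \<Longrightarrow> \<alpha> g x \<in> X"
  using X by (auto simp: G_AS_set_def)

lemma \<Phi>_equivariant: "g \<in> carrier G \<Longrightarrow> x \<in> X \<Longrightarrow> \<Phi> (\<alpha> g x) = coordinate_action G d \<tau> g (\<Phi> x)"
  using \<Phi> subset_zariski_closure[of X n] by (auto simp: affine_realization_def)

lemma stiefel_matrices: "A \<in> V k \<Longrightarrow> A \<in> matrices k N"
  by (simp add: stiefel_def)

lemma real_pt_mem: "z \<in> X \<times> V k \<Longrightarrow> real_pt z \<in> topspace (Euclidean_space d) \<times> matrices k N"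
  using \<Phi>_range stiefel_matrices by auto

lemma act_closed: "g \<in> carrier G \<Longrightarrow> z \<in> X \<times> V k \<Longrightarrow> act g z \<in> X \<times> V k"
  using \<alpha>_closed matrix_action_stiefel by (cases z) (auto simp: borel_action_def)

lemma real_pt_act: "g \<in> carrier G \<Longrightarrow> z \<in> X \<times> V k \<Longrightarrow> real_pt (act g z) = action g (real_pt z)"
  using \<Phi>_equivariant by (cases z) (auto simp: borel_action_def)

lemma real_pt_inj: "z \<in> X \<times> V k \<Longrightarrow> w \<in> X \<times> V k \<Longrightarrow> real_pt z = real_pt w \<Longrightarrow> z = w"
  using \<Phi>_inj by (auto simp: inj_on_def prod_eq_iff)

text \<open>As \<open>\<Phi>\<close> is injective and equivariant, the laws of the action on \<open>X\<close> follow from those of the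
  linear one.\<close>

lemma act_mult:
  assumes "g \<in> carrier G" "h \<in> carrier G" "z \<in> X \<times> V k"
  shows "act g (act h z) = act (g \<otimes> h) z"
proof (rule real_pt_inj)
  note closed = act_closed[OF assms(2,3)]
  show "act g (act h z) \<in> X \<times> V k" by (rule act_closed[OF assms(1) closed])
  show "act (g \<otimes> h) z \<in> X \<times> V k" by (rule act_closed[OF m_closed[OF assms(1,2)] assms(3)])
  show "real_pt (act g (act h z)) = real_pt (act (g \<otimes> h) z)"
    by (simp only: real_pt_act[OF assms(1) closed] real_pt_act[OF assms(2,3)]
        real_pt_act[OF m_closed[OF assms(1,2)] assms(3)] action_mult[OF assms(1,2)])
qed

lemma act_one:
  assumes "z \<in> X \<times> V k"
  shows "act \<one> z = z"
proof (rule real_pt_inj[OF act_closed[OF one_closed assms] assms])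
  show "real_pt (act \<one> z) = real_pt z"
    by (simp only: real_pt_act[OF one_closed assms] action_one[OF real_pt_mem[OF assms]])
qed

lemma orbit_of_self: "z \<in> X \<times> V k \<Longrightarrow> z \<in> orbit_of z"
  unfolding orbit_def using act_one[of z k] one_closed by force

lemma orbit_of_act:
  assumes g: "g \<in> carrier G" and z: "z \<in> X \<times> V k"
  shows "orbit_of (act g z) = orbit_of z"
proof -
  have sub: "orbit_of (act g z) \<subseteq> orbit_of z" if g: "g \<in> carrier G" and z: "z \<in> X \<times> V k" for g z
  proof
    fix w assume "w \<in> orbit_of (act g z)"
    then obtain h where h: "h \<in> carrier G" "w = act h (act g z)" unfolding orbit_def by blast
    then have "w = act (h \<otimes> g) z" using act_mult[OF h(1) g z] by simp
    then show "w \<in> orbit_of z" unfolding orbit_def using m_closed[OF h(1) g] by blast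
  qed
  have "act (inv g) (act g z) = z"
    using act_mult[OF inv_closed[OF g] g z] act_one[OF z] l_inv[OF g] by simp
  then show ?thesis
    using sub[OF g z] sub[OF inv_closed[OF g] act_closed[OF g z]] by simp
qed

lemma orbit_of_eq_iff:
  assumes "z \<in> X \<times> V k" and "w \<in> X \<times> V l"
  shows "orbit_of z = orbit_of w \<longleftrightarrow> (\<exists>g\<in>carrier G. act g z = w)"
proof
  assume "orbit_of z = orbit_of w"
  then have "w \<in> orbit_of z" using orbit_of_self[OF assms(2)] by simp
  then show "\<exists>g\<in>carrier G. act g z = w" unfolding orbit_def by blast
next
  assume "\<exists>g\<in>carrier G. act g z = w"
  then show "orbit_of z = orbit_of w" using orbit_of_act[OF _ assms(1)] by blast
qed

lemma pi_map_eq_iff: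
  assumes z: "z \<in> X \<times> V k" and w: "w \<in> X \<times> V k"
  shows "pi_map k z = pi_map k w \<longleftrightarrow> orbit_of z = orbit_of w"
proof
  assume "pi_map k z = pi_map k w"
  then obtain g where g: "g \<in> carrier G" "action g (real_pt z) = real_pt w"
    using quotient_map_pi_eqD[OF P real_pt_mem[OF z] real_pt_mem[OF w]] unfolding pi_map_def by blast
  then have "real_pt (act g z) = real_pt w" using real_pt_act[OF g(1) z] by simp
  then have "act g z = w" using real_pt_inj[OF act_closed[OF g(1) z] w] by blast
  then show "orbit_of z = orbit_of w" using orbit_of_eq_iff[OF z w] g(1) by blast
next
  assume "orbit_of z = orbit_of w"
  then obtain g where g: "g \<in> carrier G" "act g z = w" using orbit_of_eq_iff[OF z w] by blast
  have "pi_map k (act g z) = pi_map k z"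
    unfolding pi_map_def real_pt_act[OF g(1) z] by (rule quotient_map_pi_action[OF P g(1) real_pt_mem[OF z]])
  then show "pi_map k z = pi_map k w" using g(2) by simp
qed

lemma quotient_map_pi_image: "quotient_map_pi P k ` (\<Phi> ` X \<times> V k) = pi_map k ` (X \<times> V k)"
  unfolding pi_map_def by force

lemma approx_space_eq: "S k = top_of_set (pi_map k ` (X \<times> V k))"
  unfolding approx_space_def quotient_map_pi_image
  by (rule subtopology_Euclidean_space) (auto simp: pi_map_def quotient_map_pi_def topspace_Euclidean_space)

lemma topspace_approx_space: "topspace (S k) = pi_map k ` (X \<times> V k)"
  by (simp add: approx_space_eq)

lemma j_pi_map:
  assumes "z \<in> X \<times> V k"
  shows "j k (pi_map k z) = orbit_of z"
proof -
  have pi: "(\<lambda>(x, A). quotient_map_pi P k (\<Phi> x, A)) = pi_map k"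
    by (auto simp: pi_map_def fun_eq_iff)
  have w: "pi_map k z \<in> pi_map k ` (X \<times> V k)" using assms by blast
  have "orbit_of (inv_into (X \<times> V k) (pi_map k) (pi_map k z)) = orbit_of z"
    using pi_map_eq_iff[OF inv_into_into[OF w] assms] f_inv_into_f[OF w] by blast
  then show ?thesis unfolding approx_to_borel_def pi .
qed

lemma j_image: "j k ` topspace (S k) = orbit_of ` (X \<times> V k)"
  unfolding topspace_approx_space image_image by (rule image_cong) (simp_all only: j_pi_map)

lemma j_inj: "inj_on (j k) (topspace (S k))"
  unfolding topspace_approx_space by (rule inj_onI) (use j_pi_map pi_map_eq_iff in force)

lemma openin_borel_space:
  "openin B U \<longleftrightarrow> U \<subseteq> orbit_of ` topspace total_space \<and> openin total_space {z \<in> topspace total_space. orbit_of z \<in> U}"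
  unfolding borel_space_def orbit_space_def by (rule openin_quotient_topology)

lemma topspace_borel_space: "topspace B = orbit_of ` topspace total_space"
  unfolding borel_space_def orbit_space_def by (rule topspace_quotient_topology)

lemma closedin_borel_space:
  "closedin B C \<longleftrightarrow> C \<subseteq> orbit_of ` topspace total_space \<and> closedin total_space {z \<in> topspace total_space. orbit_of z \<in> C}"
proof -
  have "{z \<in> topspace total_space. orbit_of z \<in> orbit_of ` topspace total_space - C} =
      topspace total_space - {z \<in> topspace total_space. orbit_of z \<in> C}" by blast
  then show ?thesis
    unfolding closedin_def topspace_borel_space openin_borel_space by auto
qed

lemma subtopology_total: "subtopology total_space (X \<times> V k) = prod_topology X_top (top_of_set (V k))"
proof -
  have "subtopology X_top X = X_top" by (simp add: subtopology_subtopology)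
  then show ?thesis
    using subtopology_Times[of X_top "stiefel_infinity N" X "V k"] by (simp add: subtopology_stiefel_infinity)
qed

lemma closedin_total: "closedin total_space (X \<times> V k)"
  using closedin_X_top closedin_stiefel[of N k] by (simp add: closedin_prod_Times_iff)

lemma continuous_map_pi_map: "continuous_map (subtopology total_space (X \<times> V k)) (S k) (pi_map k)"
proof -
  have "continuous_map X_top euclidean \<Phi>"
    using homeomorphic_imp_continuous_map[OF \<Phi>_homeo] by (simp add: continuous_map_in_subtopology)
  moreover have "continuous_map (top_of_set (V k)) euclidean (\<lambda>A. A)" by simp
  ultimately have "continuous_map (prod_topology X_top (top_of_set (V k)))
      (prod_topology euclidean euclidean) (\<lambda>z. real_pt z)"
    unfolding continuous_map_pairwise comp_def fst_conv snd_conv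
    using continuous_map_compose[OF continuous_map_fst, unfolded comp_def]
      continuous_map_compose[OF continuous_map_snd, unfolded comp_def] by blast
  moreover have "continuous_map (prod_topology euclidean euclidean) euclidean (quotient_map_pi P k)"
    using continuous_on_quotient_map_pi[OF P] by simp
  ultimately have "continuous_map (subtopology total_space (X \<times> V k)) euclidean (pi_map k)"
    unfolding subtopology_total pi_map_def[abs_def] using continuous_map_compose[unfolded comp_def] by blast
  moreover have "topspace (subtopology total_space (X \<times> V k)) = X \<times> V k"
    unfolding subtopology_total by (simp only: topspace_prod_topology topspace_X_top topspace_euclidean_subtopology)
  ultimately show ?thesis
    unfolding approx_space_eq continuous_map_in_subtopology by (simp add: image_subset_iff_funcset[symmetric])
qed

text \<open>This is where the inverse of \<open>\<Phi>\<close> has to be continuous: a neighbourhood of \<open>z\<close> contains all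
  points of the stage whose realizations are at a small distance from that of \<open>z\<close>.\<close>

lemma pi_map_near:
  assumes U: "openin total_space U" and z: "z \<in> U" "z \<in> X \<times> V k"
  shows "\<exists>W. open W \<and> pi_map k z \<in> W \<and> (\<forall>w\<in>X \<times> V k. pi_map k w \<in> W \<longrightarrow> (\<exists>g\<in>carrier G. act g w \<in> U))"
proof -
  obtain U1 U2 where U12: "openin X_top U1" "openin (stiefel_infinity N) U2" "fst z \<in> U1" "snd z \<in> U2"
    and sub: "U1 \<times> U2 \<subseteq> U"
    using U z(1) unfolding openin_prod_topology_alt by (metis prod.collapse)
  have "openin (top_of_set (\<Phi> ` X)) (\<Phi> ` U1)"
    using \<Phi>_homeo U12(1) by (meson homeomorphic_map_openness openin_subset)
  then obtain Q1 where Q1: "open Q1" "\<Phi> ` U1 = \<Phi> ` X \<inter> Q1" by (auto simp: openin_open)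
  have "openin (top_of_set (V k)) (U2 \<inter> V k)"
    using U12(2) by (simp add: openin_stiefel_infinity)
  then obtain Q2 where Q2: "open Q2" "U2 \<inter> V k = V k \<inter> Q2" by (auto simp: openin_open)
  have "U1 \<subseteq> X" using openin_subset[OF U12(1)] by simp
  have mem: "w \<in> U" if w: "w \<in> X \<times> V k" "real_pt w \<in> Q1 \<times> Q2" for w
  proof -
    have "\<Phi> (fst w) \<in> \<Phi> ` U1" "snd w \<in> U2" using w Q1(2) Q2(2) by auto
    then obtain u where "u \<in> U1" "\<Phi> (fst w) = \<Phi> u" by blast
    moreover have "fst w \<in> X" using w(1) by auto
    ultimately have "fst w \<in> U1" using inj_onD[OF \<Phi>_inj] \<open>U1 \<subseteq> X\<close> by blast
    then show ?thesis using sub \<open>snd w \<in> U2\<close> by (cases w) auto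
  qed
  have "real_pt z \<in> Q1 \<times> Q2" using U12(3,4) z(2) Q1(2) Q2(2) by auto
  from sq_dist_open[OF Q1(1) Q2(1) this real_pt_mem[OF z(2)]] obtain \<epsilon> where "\<epsilon> > 0"
    and \<epsilon>: "\<And>y. y \<in> topspace (Euclidean_space d) \<times> matrices k N \<Longrightarrow> sq_dist k y (real_pt z) < \<epsilon>
        \<Longrightarrow> y \<in> Q1 \<times> Q2" by blast
  from quotient_map_pi_near[OF P real_pt_mem[OF z(2)] \<open>\<epsilon> > 0\<close>] obtain W where W: "open W" "pi_map k z \<in> W"
    and near: "\<And>y. quotient_map_pi P k y \<in> W \<Longrightarrow> \<exists>g\<in>carrier G. sq_dist k (action g y) (real_pt z) < \<epsilon>"
    unfolding pi_map_def by blast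
  have "\<exists>g\<in>carrier G. act g w \<in> U" if w: "w \<in> X \<times> V k" "pi_map k w \<in> W" for w
  proof -
    from near[of "real_pt w"] w(2) obtain g where g: "g \<in> carrier G"
      "sq_dist k (action g (real_pt w)) (real_pt z) < \<epsilon>" unfolding pi_map_def by blast
    then have "real_pt (act g w) \<in> Q1 \<times> Q2"
      using \<epsilon>[OF real_pt_mem[OF act_closed[OF g(1) w(1)]]] real_pt_act[OF g(1) w(1)] by simp
    then show ?thesis using mem[OF act_closed[OF g(1) w(1)]] g(1) by blast
  qed
  with W show ?thesis by blast
qed

lemma stage_in_total_space: "z \<in> X \<times> V k \<Longrightarrow> z \<in> topspace total_space"
  unfolding topspace_total_space by blast

lemma continuous_map_j: "continuous_map (S k) B (j k)"
  unfolding continuous_map_def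
proof (intro conjI allI impI)
  show "j k \<in> topspace (S k) \<rightarrow> topspace B"
    unfolding image_subset_iff_funcset[symmetric] j_image topspace_borel_space using stage_in_total_space by blast
  fix Q assume Q: "openin B Q"
  let ?U = "{z \<in> topspace total_space. orbit_of z \<in> Q}"
  have U: "openin total_space ?U" using Q openin_borel_space by blast
  show "openin (S k) {y \<in> topspace (S k). j k y \<in> Q}"
  proof (subst openin_subopen, intro ballI)
    fix y assume "y \<in> {y \<in> topspace (S k). j k y \<in> Q}"
    then obtain z where z: "z \<in> X \<times> V k" "y = pi_map k z" "orbit_of z \<in> Q"
      unfolding topspace_approx_space using j_pi_map by auto
    then have "z \<in> ?U" using stage_in_total_space by blast
    from pi_map_near[OF U this z(1)] obtain W where W: "open W" "pi_map k z \<in> W"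
      and near: "\<And>w. w \<in> X \<times> V k \<Longrightarrow> pi_map k w \<in> W \<Longrightarrow> \<exists>g\<in>carrier G. act g w \<in> ?U" by blast
    show "\<exists>E. openin (S k) E \<and> y \<in> E \<and> E \<subseteq> {y \<in> topspace (S k). j k y \<in> Q}"
    proof (intro exI conjI)
      show "openin (S k) (topspace (S k) \<inter> W)"
        using W(1) by (simp add: approx_space_eq openin_open_Int)
      show "y \<in> topspace (S k) \<inter> W" using z W(2) by (simp add: topspace_approx_space)
      show "topspace (S k) \<inter> W \<subseteq> {y \<in> topspace (S k). j k y \<in> Q}"
      proof
        fix v assume v: "v \<in> topspace (S k) \<inter> W"
        then obtain w where w: "w \<in> X \<times> V k" "v = pi_map k w" unfolding topspace_approx_space by auto
        with near[of w] v obtain g where g: "g \<in> carrier G" "act g w \<in> ?U" by blast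
        then have "j k v \<in> Q" using j_pi_map[OF w(1)] orbit_of_act[OF g(1) w(1)] w(2) by simp
        then show "v \<in> {y \<in> topspace (S k). j k y \<in> Q}" using v by blast
      qed
    qed
  qed
qed

text \<open>The preimage \<open>?D\<close> in \<open>X \<times> V\<^sub>k\<close> of a closed set is closed in the whole of \<open>X \<times> V\<^sub>\<infinity>\<close> because
  the stage is. It is a union of orbits, since the group preserves the stage and the values of
  \<open>\<pi>\<^sub>k\<close>; thus its image in the quotient is closed.\<close>

lemma closed_map_j: "closed_map (S k) B (j k)"
  unfolding closed_map_def
proof (intro allI impI)
  fix C assume C: "closedin (S k) C"
  let ?D = "{z \<in> X \<times> V k. pi_map k z \<in> C}"
  have "topspace (subtopology total_space (X \<times> V k)) = X \<times> V k"
    unfolding topspace_subtopology using stage_in_total_space by blast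
  then have "closedin (subtopology total_space (X \<times> V k)) ?D"
    using closedin_continuous_map_preimage[OF continuous_map_pi_map C] by simp
  then have D: "closedin total_space ?D"
    using closedin_closed_subtopology[OF closedin_total] by blast
  have sub: "C \<subseteq> pi_map k ` (X \<times> V k)" using closedin_subset[OF C] by (simp add: topspace_approx_space)
  have img: "j k ` C = orbit_of ` ?D"
  proof (intro subset_antisym subsetI)
    fix y assume "y \<in> j k ` C"
    then obtain z where "z \<in> X \<times> V k" "pi_map k z \<in> C" "y = j k (pi_map k z)" using sub by blast
    then show "y \<in> orbit_of ` ?D" using j_pi_map by auto
  next
    fix y assume "y \<in> orbit_of ` ?D"
    then obtain z where "z \<in> X \<times> V k" "pi_map k z \<in> C" "y = orbit_of z" by blast
    then show "y \<in> j k ` C" using j_pi_map by blast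
  qed
  have "{z \<in> topspace total_space. orbit_of z \<in> orbit_of ` ?D} = ?D"
  proof (intro subset_antisym subsetI)
    fix z assume z: "z \<in> {z \<in> topspace total_space. orbit_of z \<in> orbit_of ` ?D}"
    then obtain w l where w: "w \<in> X \<times> V k" "pi_map k w \<in> C" "orbit_of w = orbit_of z" and l: "z \<in> X \<times> V l"
      unfolding topspace_total_space by fastforce
    from w(3) obtain g where "g \<in> carrier G" "act g w = z" using orbit_of_eq_iff[OF w(1) l] by blast
    then have "z \<in> X \<times> V k" using act_closed w(1) by blast
    moreover from this have "pi_map k z = pi_map k w" using pi_map_eq_iff[OF w(1)] w(3) by metis
    ultimately show "z \<in> ?D" using w(2) by simp
  qed (use stage_in_total_space in blast)
  moreover have "orbit_of ` ?D \<subseteq> orbit_of ` topspace total_space" using stage_in_total_space by blast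
  ultimately show "closedin B (j k ` C)" unfolding img closedin_borel_space using D by simp
qed

lemma embedding_map_j: "embedding_map (S k) B (j k)"
  by (rule injective_closed_imp_embedding_map[OF continuous_map_j closed_map_j j_inj])

text \<open>If \<open>K\<close> contained for each \<open>k\<close> an orbit \<open>y k\<close> outside of the \<open>k\<close>-th stage, then the sets \<open>U m\<close> of
  all orbits whose matrices do not occur in any \<open>y k\<close> with \<open>k \<ge> m\<close> would be an increasing open cover of
  \<open>K\<close> without a finite subcover, as \<open>U m\<close> misses \<open>y m\<close>.\<close>

lemma compactin_borel_space:
  assumes K: "compactin B K"
  shows "\<exists>k. K \<subseteq> j k ` topspace (S k)"
proof (rule ccontr)
  assume "\<not> ?thesis"
  then have "\<forall>k. \<exists>y. y \<in> K \<and> y \<notin> orbit_of ` (X \<times> V k)" unfolding j_image by blast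
  then obtain y where y: "\<And>k. y k \<in> K" "\<And>k. y k \<notin> orbit_of ` (X \<times> V k)" by metis
  have KB: "K \<subseteq> orbit_of ` topspace total_space" using compactin_subset_topspace[OF K] topspace_borel_space by simp
  then have "\<forall>k. \<exists>z. z \<in> topspace total_space \<and> y k = orbit_of z" using y(1) by blast
  then obtain z where z: "\<And>k. z k \<in> topspace total_space" "\<And>k. y k = orbit_of (z k)" by metis
  \<comment> \<open>The matrices of \<open>y k\<close> are not in \<open>V k\<close>, so a given stage contains only finitely many elements
    of \<open>M m\<close>, and \<open>M m\<close> is closed.\<close>
  define M where "M m = {matrix_action G N \<rho> g (snd (z k)) | g k. g \<in> carrier G \<and> k \<ge> m}" for m
  have stage: "\<exists>l. z k \<in> X \<times> V l" for k using z(1)[of k] unfolding topspace_total_space by auto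
  have notin: "matrix_action G N \<rho> g (snd (z k)) \<notin> V l" if g: "g \<in> carrier G" and "l \<le> k" for g k l
  proof
    assume a: "matrix_action G N \<rho> g (snd (z k)) \<in> V l"
    obtain l' where l': "z k \<in> X \<times> V l'" using stage[of k] ..
    have "act g (z k) = (\<alpha> g (fst (z k)), matrix_action G N \<rho> g (snd (z k)))"
      by (simp add: borel_action_def map_prod_def case_prod_beta)
    then have "act g (z k) \<in> X \<times> V k"
      using a stiefel_mono[OF \<open>l \<le> k\<close>] act_closed[OF g l'] by auto
    then have "orbit_of (act g (z k)) \<in> orbit_of ` (X \<times> V k)" by (rule imageI)
    then show False using y(2)[of k] unfolding z(2)[of k] orbit_of_act[OF g l'] by contradiction
  qed
  have M_stage: "finite (M m \<inter> V l)" for m l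
  proof -
    have "M m \<inter> V l \<subseteq> (\<lambda>(g, k). matrix_action G N \<rho> g (snd (z k))) ` (carrier G \<times> {..<l})"
    proof
      fix A assume A: "A \<in> M m \<inter> V l"
      then obtain g k where gk: "g \<in> carrier G" "A = matrix_action G N \<rho> g (snd (z k))" unfolding M_def by blast
      then have "k < l" using notin[OF gk(1), of l k] A by (meson IntD2 not_le)
      then show "A \<in> (\<lambda>(g, k). matrix_action G N \<rho> g (snd (z k))) ` (carrier G \<times> {..<l})"
        using gk by auto
    qed
    then show ?thesis by (rule finite_subset) (simp add: finite_G)
  qed
  have M_sub: "M m \<subseteq> (\<Union>l. V l)" for m
  proof
    fix A assume "A \<in> M m"
    then obtain g k where gk: "g \<in> carrier G" "A = matrix_action G N \<rho> g (snd (z k))" unfolding M_def by blast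
    obtain l where "z k \<in> X \<times> V l" using stage[of k] ..
    then have "A \<in> V l" using gk matrix_action_stiefel by auto
    then show "A \<in> (\<Union>l. V l)" by blast
  qed
  have M_closed: "closedin (stiefel_infinity N) (M m)" for m
    unfolding closedin_stiefel_infinity using M_sub M_stage finite_imp_closed by blast
  define U where "U m = {orbit_of w | w. w \<in> topspace total_space \<and> snd w \<notin> M m}" for m
  have M_inv: "matrix_action G N \<rho> g A \<in> M m" if "A \<in> M m" "g \<in> carrier G" for g A m
  proof -
    obtain h k where hk: "h \<in> carrier G" "k \<ge> m" "A = matrix_action G N \<rho> h (snd (z k))"
      using \<open>A \<in> M m\<close> unfolding M_def by blast
    then have "matrix_action G N \<rho> g A = matrix_action G N \<rho> (g \<otimes> h) (snd (z k))"
      by (simp add: matrix_action_mult that(2))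
    then show ?thesis unfolding M_def using hk that(2) m_closed by blast
  qed
  have U_pre: "{w \<in> topspace total_space. orbit_of w \<in> U m} = topspace total_space - X \<times> M m" for m
  proof (intro subset_antisym subsetI)
    fix w assume w: "w \<in> {w \<in> topspace total_space. orbit_of w \<in> U m}"
    then obtain v where v: "v \<in> topspace total_space" "snd v \<notin> M m" "orbit_of w = orbit_of v" unfolding U_def by blast
    obtain l l' where l: "w \<in> X \<times> V l" "v \<in> X \<times> V l'"
      using w v(1) unfolding topspace_total_space by fastforce
    from v(3) obtain g where g: "g \<in> carrier G" "act g w = v" using orbit_of_eq_iff[OF l] by blast
    have "snd v = matrix_action G N \<rho> g (snd w)"
      unfolding g(2)[symmetric] by (simp add: borel_action_def map_prod_def case_prod_beta)
    then have "snd w \<notin> M m" using v(2) M_inv[OF _ g(1)] by metis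
    then show "w \<in> topspace total_space - X \<times> M m" using w by auto
  next
    fix w assume "w \<in> topspace total_space - X \<times> M m"
    then show "w \<in> {w \<in> topspace total_space. orbit_of w \<in> U m}" unfolding U_def topspace_total_space by auto
  qed
  have "closedin total_space (X \<times> M m)" for m
    using closedin_X_top M_closed by (simp add: closedin_prod_Times_iff)
  then have "openin total_space {w \<in> topspace total_space. orbit_of w \<in> U m}" for m
    unfolding U_pre by (rule openin_diff[OF openin_topspace])
  then have U_open: "openin B (U m)" for m
    unfolding openin_borel_space U_def by blast
  have "K \<subseteq> \<Union>(range U)"
  proof
    fix x assume "x \<in> K"
    then obtain w where w: "w \<in> topspace total_space" "x = orbit_of w" using KB by blast
    then obtain l where "snd w \<in> V l" unfolding topspace_total_space by auto
    have "snd w \<notin> M l"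
    proof
      assume "snd w \<in> M l"
      then obtain g k where gk: "g \<in> carrier G" "l \<le> k" "snd w = matrix_action G N \<rho> g (snd (z k))"
        unfolding M_def by blast
      then show False using notin[OF gk(1,2)] \<open>snd w \<in> V l\<close> by simp
    qed
    then show "x \<in> \<Union>(range U)" unfolding U_def using w by blast
  qed
  moreover have "\<forall>Q\<in>range U. openin B Q" using U_open by blast
  ultimately obtain F where F: "finite F" "F \<subseteq> range U" "K \<subseteq> \<Union>F"
    using K unfolding compactin_def by blast
  obtain I where I: "finite I" "F = U ` I" using finite_subset_image[OF F(1,2)] by blast
  define m where "m = Max (insert 0 I)"
  have "U i \<subseteq> U m" if "i \<in> I" for i
  proof -
    have "i \<le> m" unfolding m_def using I(1) that by (intro Max_ge) auto
    have "M m \<subseteq> M i"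
    proof
      fix A assume "A \<in> M m"
      then obtain g k where "g \<in> carrier G" "m \<le> k" "A = matrix_action G N \<rho> g (snd (z k))"
        unfolding M_def by blast
      moreover from this have "i \<le> k" using \<open>i \<le> m\<close> by simp
      ultimately show "A \<in> M i" unfolding M_def by blast
    qed
    then show ?thesis unfolding U_def by blast
  qed
  then have "K \<subseteq> U m" using F(3) I(2) by blast
  then have "y m \<in> U m" using y(1)[of m] by (rule subsetD)
  then have "z m \<in> topspace total_space - X \<times> M m" unfolding U_pre[symmetric] using z by simp
  moreover have "snd (z m) \<in> M m"
  proof -
    obtain l where "z m \<in> X \<times> V l" using stage[of m] ..
    then have "snd (z m) = matrix_action G N \<rho> \<one> (snd (z m))"
      using matrix_action_one[OF stiefel_matrices, of "snd (z m)" l] by auto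
    then show ?thesis unfolding M_def using one_closed by blast
  qed
  ultimately show False unfolding topspace_total_space by auto
qed

lemma approx_inclusion_lift:
  assumes "w \<in> topspace (S k)"
  shows "\<exists>z\<in>X \<times> V k. w = pi_map k z \<and> approx_inclusion N P (\<Phi> ` X) k w = pi_map (Suc k) z"
proof -
  let ?z = "inv_into (\<Phi> ` X \<times> V k) (quotient_map_pi P k) w"
  have w: "w \<in> quotient_map_pi P k ` (\<Phi> ` X \<times> V k)"
    using assms unfolding topspace_approx_space quotient_map_pi_image .
  obtain x A where x: "x \<in> X" "A \<in> V k" "?z = (\<Phi> x, A)" using inv_into_into[OF w] by auto
  have "quotient_map_pi P k ?z = w" using f_inv_into_f[OF w] .
  then show ?thesis
    unfolding approx_inclusion_def using x by (intro bexI[of _ "(x, A)"]) (auto simp: pi_map_def)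
qed

theorem approximation_iso:
  "direct_limit_map (\<lambda>k. hom_induced2 p B (j k)) \<in>
     iso (direct_limit (\<lambda>k. homology2 p (S k))
            (\<lambda>k. hom_induced2 p (S (Suc k)) (approx_inclusion N P (\<Phi> ` X) k)))
         (homology2 p B)"
proof (rule homology2_direct_limit)
  show "embedding_map (S k) B (j k)" for k by (rule embedding_map_j)
  show "\<exists>k. K \<subseteq> j k ` topspace (S k)" if "compactin B K" for K by (rule compactin_borel_space[OF that])
  fix k w assume "w \<in> topspace (S k)"
  then obtain z where z: "z \<in> X \<times> V k" "w = pi_map k z" "approx_inclusion N P (\<Phi> ` X) k w = pi_map (Suc k) z"
    using approx_inclusion_lift by blast
  then have z': "z \<in> X \<times> V (Suc k)" using stiefel_mono[of k "Suc k" N] by auto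
  show "approx_inclusion N P (\<Phi> ` X) k w \<in> topspace (S (Suc k))"
    unfolding z(3) topspace_approx_space using z' by blast
  show "j (Suc k) (approx_inclusion N P (\<Phi> ` X) k w) = j k w"
    unfolding z(3) using z(2) j_pi_map[OF z(1)] j_pi_map[OF z'] by simp
qed

end

theorem proposition4p5:
  fixes G :: "('g, 'b) monoid_scheme" and N n d p :: nat
    and \<rho> \<tau> :: "'g \<Rightarrow> nat \<Rightarrow> nat"
    and X :: "proj_point set" and \<alpha> :: "'g \<Rightarrow> proj_point \<Rightarrow> proj_point"
    and \<Phi> :: "proj_point \<Rightarrow> nat \<Rightarrow> real"
    and P :: "nat \<Rightarrow> ((nat \<Rightarrow> real) \<times> real_matrix \<Rightarrow> real) list"
  assumes "group G" and "finite (carrier G)" and "order G = N"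
    and "faithful_action G {..<N} \<rho>"
    and "G_AS_set G n \<alpha> X"
    and "affine_realization G n \<alpha> X d \<tau> \<Phi>"
    and "invariant_generators G d \<tau> N \<rho> P"
  shows "direct_limit_map
           (\<lambda>k. hom_induced2 p (borel_space G N \<rho> n \<alpha> X) (approx_to_borel G N \<rho> \<alpha> X \<Phi> P k))
         \<in> iso (direct_limit
                 (\<lambda>k. homology2 p (approx_space N P (\<Phi> ` X) k))
                 (\<lambda>k. hom_induced2 p (approx_space N P (\<Phi> ` X) (Suc k))
                        (approx_inclusion N P (\<Phi> ` X) k)))
               (equivariant_homology2 p G N \<rho> n \<alpha> X)"
proof -
  have "permutation_actions G d N \<tau> \<rho>"
    using assms(1,2,4,6) faithful_action.axioms(1)
    by (simp add: permutation_actions_def permutation_actions_axioms_def affine_realization_def)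
  then interpret borel_approximation G d N \<tau> \<rho> n X \<alpha> \<Phi> P
    using assms(5-7) by (simp add: borel_approximation_def borel_approximation_axioms_def)
  show ?thesis
    unfolding equivariant_homology2_def by (rule approximation_iso)
qed

end
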